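(* Let $F\subset k[x_1,\ldots,x_n]$ be a Cremona set of degree $2$ satisfying the canonical restrictions and let $G_F$ be the corresponding graph. Let $r$ denote the size of the unique circuit (possibly a loop, in which case $r=1$) in $G_F$, let $s$ be the number of vertices of $G_F$ off the circuit whose vertex degree is $\geq 2$, and let $s_2$ be the number of edges in the second neighborhood of the circuit. The following conditions are equivalent: (a) $F$ is a $p$-involution. (b) The inverse $F^{-1}$ has degree $2$. (c) Either $r=3$ and $s_2=0$, or else $r=1$ and $s=1$.
   Context: Let $k$ be a field (of arbitrary characteristic) and $n\ge 2$. For $v=(a_1,\ldots,a_n)\in\mathbb{N}^n$ write $\mathbf{x}^v=x_1^{a_1}\cdots x_n^{a_n}$. Let $F=\{\mathbf{x}^{v_1},\ldots,\mathbf{x}^{v_n}\}$ be a set of $n$ distinct monomials of the same degree; its log-matrix $A_F$ has $j$th column $v_j$. $F$ satisfies the canonical restrictions if the monomials have no non-trivial common factor and every variable divides at least one of them. $F$ is a Cremona set if the rational map $\mathbb{P}^{n-1}\dashrightarrow\mathbb{P}^{n-1}$ with coordinates $(\mathbf{x}^{v_1}:\cdots:\mathbf{x}^{v_n})$ is birational. For a Cremona set $F$ satisfying the canonical restrictions, there are a unique set $F^{-1}$ of $n$ monomials of a common degree satisfying the canonical restrictions, with log-matrix $A_{F^{-1}}$, and a unique vector $\gamma\in\mathbb{N}^n$ such that $A_F\cdot A_{F^{-1}}=[\gamma|\cdots|\gamma]+I_n$; $F^{-1}$ defines the inverse map and its degree is the common degree of its monomials. $F$ is a $p$-involution if it coincides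 with $F^{-1}$ up to permutations on the source and on the target, i.e. $A_{F^{-1}}=PA_FQ$ for some permutation matrices $P,Q$. For $F$ of degree $2$, the graph $G_F$ has vertices $x_1,\ldots,x_n$, an edge joining $x_i$ and $x_j$ for each $x_ix_j\in F$ ($i\ne j$) and a loop at $x_i$ for each $x_i^2\in F$. For a Cremona set of degree $2$ satisfying the canonical restrictions, $G_F$ is connected and is either a loopless graph with a unique circuit, of odd length $r\ge 3$, or a tree plus exactly one loop ($r=1$; the loop with its vertex plays the role of the circuit). The $j$th neighborhood of the circuit consists of the vertices at distance $j\ge1$ from the circuit, and its edges are those joining a vertex at distance $j-1$ to a vertex at distance $j$. *)

theory Defs
  imports "HOL-Analysis.Analysis" "HOL-Library.Poly_Mapping"
begin

text \<open>
  The finite type \<open>'n\<close>, with \<open>n = CARD('n)\<close>, indexes both the variables and the members of a set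
  of \<open>n\<close> monomials. Such a set is given by the family \<open>v\<close> of its exponent vectors, that is, together
  with an enumeration: the matrix \<open>log_matrix v\<close> and the inverse set depend on the enumeration
  (reordering the monomials renames the variables of the inverse), whereas the property of being a
  Cremona set, the graph and the property of being a p-involution do not.
\<close>

section \<open>Polynomials and rational maps\<close>

type_synonym ('n, 'k) mpoly = "('n \<Rightarrow>\<^sub>0 nat) \<Rightarrow>\<^sub>0 'k"

definition Const :: "'k::field \<Rightarrow> ('n, 'k) mpoly" where
  "Const c = Poly_Mapping.single 0 c"

definition Var :: "'n \<Rightarrow> ('n, 'k::field) mpoly" where
  "Var i = Poly_Mapping.single (Poly_Mapping.single i 1) 1"

definition subst :: "('n::finite \<Rightarrow> ('n, 'k::field) mpoly) \<Rightarrow> ('n, 'k) mpoly \<Rightarrow> ('n, 'k) mpoly" where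
  "subst f p = (\<Sum>m\<in>Poly_Mapping.keys p. Const (Poly_Mapping.lookup p m) *
                   (\<Prod>i\<in>UNIV. f i ^ Poly_Mapping.lookup m i))"

definition homogeneous :: "nat \<Rightarrow> ('n::finite, 'k::field) mpoly \<Rightarrow> bool" where
  "homogeneous d p \<longleftrightarrow> (\<forall>m\<in>Poly_Mapping.keys p. (\<Sum>i\<in>UNIV. Poly_Mapping.lookup m i) = d)"

text \<open>
  A rational map from projective \<open>(n - 1)\<close>-space to itself is represented by a tuple of forms of one
  degree, not all zero; two such tuples represent the same map iff they are proportional over
  \<open>k(x\<^sub>1, \<dots>, x\<^sub>n)\<close>, which is expressed by the vanishing of the \<open>2 \<times> 2\<close> minors.
\<close>

definition rational_map :: "('n::finite \<Rightarrow> ('n, 'k::field) mpoly) \<Rightarrow> bool" where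
  "rational_map f \<longleftrightarrow> (\<exists>d. \<forall>i. homogeneous d (f i)) \<and> (\<exists>i. f i \<noteq> 0)"

definition same_map :: "('n::finite \<Rightarrow> ('n, 'k::field) mpoly) \<Rightarrow> ('n \<Rightarrow> ('n, 'k) mpoly) \<Rightarrow> bool" where
  "same_map f g \<longleftrightarrow> (\<forall>i j. f i * g j = f j * g i)"

definition comp_map ::
  "('n::finite \<Rightarrow> ('n, 'k::field) mpoly) \<Rightarrow> ('n \<Rightarrow> ('n, 'k) mpoly) \<Rightarrow> 'n \<Rightarrow> ('n, 'k) mpoly" where
  "comp_map g f = (\<lambda>i. subst f (g i))"

text \<open>The conditions \<open>rational_map (comp_map _ _)\<close> say that the composites are defined.\<close>

definition birational :: "('n::finite \<Rightarrow> ('n, 'k::field) mpoly) \<Rightarrow> bool" where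
  "birational f \<longleftrightarrow> rational_map f \<and>
     (\<exists>g. rational_map g \<and>
          rational_map (comp_map g f) \<and> same_map (comp_map g f) Var \<and>
          rational_map (comp_map f g) \<and> same_map (comp_map f g) Var)"


section \<open>Sets of monomials\<close>

definition monomial :: "nat^'n \<Rightarrow> ('n::finite, 'k::field) mpoly" where
  "monomial a = (\<Prod>i\<in>UNIV. Var i ^ (a $ i))"

definition has_degree :: "('n::finite \<Rightarrow> nat^'n) \<Rightarrow> nat \<Rightarrow> bool" where
  "has_degree v d \<longleftrightarrow> (\<forall>j. (\<Sum>i\<in>UNIV. v j $ i) = d)"

definition monomial_set :: "('n::finite \<Rightarrow> nat^'n) \<Rightarrow> bool" where
  "monomial_set v \<longleftrightarrow> inj v \<and> (\<exists>d. has_degree v d)"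

definition log_matrix :: "('n::finite \<Rightarrow> nat^'n) \<Rightarrow> nat^'n^'n" where
  "log_matrix v = (\<chi> i j. v j $ i)"

text \<open>Divisibility of monomials is the componentwise order of their exponent vectors.\<close>

definition canonical_restrictions :: "('n::finite \<Rightarrow> nat^'n) \<Rightarrow> bool" where
  "canonical_restrictions v \<longleftrightarrow>
     (\<forall>u. (\<forall>j. \<forall>i. u $ i \<le> v j $ i) \<longrightarrow> u = 0) \<and>
     (\<forall>i. \<exists>j. 1 \<le> v j $ i)"

definition cremona_set :: "'k::field itself \<Rightarrow> ('n::finite \<Rightarrow> nat^'n) \<Rightarrow> bool" where
  "cremona_set K v \<longleftrightarrow> monomial_set v \<and> birational (\<lambda>j. monomial (v j) :: ('n, 'k) mpoly)"

definition is_inverse_set :: "('n::finite \<Rightarrow> nat^'n) \<Rightarrow> ('n \<Rightarrow> nat^'n) \<Rightarrow> bool" where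
  "is_inverse_set v w \<longleftrightarrow> monomial_set w \<and> canonical_restrictions w \<and>
     (\<exists>\<gamma>::nat^'n. log_matrix v ** log_matrix w = (\<chi> i j. \<gamma> $ i) + mat 1)"

definition inverse_set :: "('n::finite \<Rightarrow> nat^'n) \<Rightarrow> 'n \<Rightarrow> nat^'n" where
  "inverse_set v = (THE w. is_inverse_set v w)"

definition permutation_matrix :: "nat^'n^'n \<Rightarrow> bool" where
  "permutation_matrix P \<longleftrightarrow> (\<exists>\<sigma>. \<sigma> permutes UNIV \<and> P = (\<chi> i j. if i = \<sigma> j then 1 else 0))"

definition p_involution :: "('n::finite \<Rightarrow> nat^'n) \<Rightarrow> bool" where
  "p_involution v \<longleftrightarrow>
     (\<exists>P Q. permutation_matrix P \<and> permutation_matrix Q \<and>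
            log_matrix (inverse_set v) = P ** log_matrix v ** Q)"


section \<open>The graph of a set of monomials of degree two\<close>

text \<open>
  The graph has vertex set \<open>UNIV :: 'n set\<close>; an edge is the set of its ends, so \<open>{i}\<close> is a loop,
  which arises from \<open>x\<^sub>i\<^sup>2\<close> by the case \<open>i = j\<close> below.
\<close>

definition graph_edges :: "('n::finite \<Rightarrow> nat^'n) \<Rightarrow> 'n set set" where
  "graph_edges v = {{i, j} | i j. axis i 1 + axis j 1 \<in> range v}"

text \<open>
  A circuit is given by its set of edges; \<open>xs\<close> lists its vertices in cyclic order. A one-element list
  is a loop; length two is excluded because it would traverse a single edge twice.
\<close>

definition is_circuit :: "'a set set \<Rightarrow> 'a set set \<Rightarrow> bool" where
  "is_circuit E C \<longleftrightarrow> C \<subseteq> E \<and>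
     (\<exists>xs. distinct xs \<and> length xs \<ge> 1 \<and> length xs \<noteq> 2 \<and>
           C = {{xs ! k, xs ! (Suc k mod length xs)} | k. k < length xs})"

definition the_circuit :: "'a set set \<Rightarrow> 'a set set" where
  "the_circuit E = (THE C. is_circuit E C)"

definition circuit_vertices :: "'a set set \<Rightarrow> 'a set" where
  "circuit_vertices E = \<Union>(the_circuit E)"

definition circuit_size :: "'a set set \<Rightarrow> nat" where
  "circuit_size E = card (the_circuit E)"

text \<open>Loops count twice.\<close>

definition vertex_degree :: "'a set set \<Rightarrow> 'a \<Rightarrow> nat" where
  "vertex_degree E i = card {e \<in> E. i \<in> e} + (if {i} \<in> E then 1 else 0)"

text \<open>The least length of a walk from the circuit; meaningful for connected graphs.\<close>

definition circuit_dist :: "'a set set \<Rightarrow> 'a \<Rightarrow> nat" where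
  "circuit_dist E i = (LEAST k. \<exists>c\<in>circuit_vertices E. (c, i) \<in> {(a, b). {a, b} \<in> E} ^^ k)"

definition neighborhood_edges :: "'a set set \<Rightarrow> nat \<Rightarrow> 'a set set" where
  "neighborhood_edges E j =
     {e \<in> E. \<exists>a b. e = {a, b} \<and> circuit_dist E a + 1 = j \<and> circuit_dist E b = j}"

definition off_circuit_branching :: "'a set set \<Rightarrow> 'a set" where
  "off_circuit_branching E = {i. i \<notin> circuit_vertices E \<and> vertex_degree E i \<ge> 2}"

end

theory Submission
  imports Defs
begin

text \<open>
  Write \<open>A\<close> for the log-matrix, whose columns are the \<open>n\<close> edges of the graph. Birationality enters only
  through exponents: comparing those in the identity of rational maps that defines the inverse shows
  that every \<open>e\<^sub>j - e\<^sub>i\<close> is an integral combination of columns (\<open>cremona_lattice\<close>). Everything needed about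
  \<open>A\<close> follows from this. Its columns are independent; the equation \<open>A W = [\<gamma>| \<dots> |\<gamma>] + I\<close> has exactly one
  solution satisfying the canonical restrictions, so \<open>inverse_set\<close> is well defined
  (\<open>inverse_set_eqI\<close>, \<open>is_inverse_set_inverse_set\<close>); and, by parity, the graph is connected
  (\<open>graph_connected\<close>). A connected graph with as many edges as vertices has exactly one circuit, so
  \<open>the_circuit\<close> is well defined too.

  The three conditions are then proved in a cycle. Permutation matrices do not change column sums,
  so (a) implies (b).

  Assume (b). Taking column sums in the equation of the inverse gives \<open>\<bar>\<gamma>\<bar> = 3\<close>, say
  \<open>\<gamma> = e\<^sub>a + e\<^sub>b + e\<^sub>c\<close>, and each column of the equation says that \<open>\<gamma> + e\<^sub>j\<close> is a sum of two edges. In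
  particular each vertex \<open>j\<close> is adjacent to \<open>a\<close>, \<open>b\<close> or \<open>c\<close>. Since there are only \<open>n\<close> edges, counting shows
  that the graph is a triangle \<open>a b c\<close> with leaves attached to it, or, if \<open>\<gamma> = 2 e\<^sub>a + e\<^sub>b\<close>, an edge \<open>a b\<close>
  with a loop at \<open>a\<close> and leaves attached to \<open>a\<close> and \<open>b\<close>; the case \<open>\<gamma> = 3 e\<^sub>a\<close> is a star, whose monomials
  have a common factor (\<open>splits_off_shape\<close>). These graphs satisfy (c).

  Assume (c). Connectedness forces one of the same two shapes. In both of them the vertices can be
  labelled bijectively with the edges in such a way that for each vertex \<open>x\<close>, with label \<open>{y, z}\<close>, the
  sum of the labels of \<open>y\<close> and \<open>z\<close> is \<open>\<gamma> + e\<^sub>x\<close>. This labelling carries the set to its inverse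
  (\<open>p_involution_of_edge_labelling\<close>), which gives (a).
\<close>


section \<open>Exponents of a birational monomial map\<close>

lemma lookup_times_Var:
  fixes p :: "('n::finite, 'k::field) mpoly"
  shows "Poly_Mapping.lookup (p * Var j) (m + Poly_Mapping.single j 1) = Poly_Mapping.lookup p m"
proof (induction p rule: update_induct)
  case const
  then show ?case by simp
next
  case (update p a c)
  have "Poly_Mapping.update a c p = p + Poly_Mapping.single a c"
    using update(1) by (intro poly_mapping_eqI)
      (auto simp: Poly_Mapping.lookup_update lookup_add lookup_single when_def in_keys_iff)
  moreover have "Poly_Mapping.lookup (Poly_Mapping.single a c * Var j) (m + Poly_Mapping.single j 1)
      = Poly_Mapping.lookup (Poly_Mapping.single a c) m"
    by (simp add: Var_def mult_single lookup_single when_def)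
  ultimately show ?case using update
    by (simp add: distrib_right lookup_add)
qed

lemma keys_times_Var:
  fixes p :: "('n::finite, 'k::field) mpoly"
  shows "Poly_Mapping.keys (p * Var j) =
    (\<lambda>m. m + Poly_Mapping.single j 1) ` Poly_Mapping.keys p"
proof
  show "Poly_Mapping.keys (p * Var j) \<subseteq>
      (\<lambda>m. m + Poly_Mapping.single j 1) ` Poly_Mapping.keys p"
    using keys_mult[of p "Var j"] by (auto simp: Var_def)
  show "(\<lambda>m. m + Poly_Mapping.single j 1) ` Poly_Mapping.keys p \<subseteq> Poly_Mapping.keys (p * Var j)"
    using lookup_times_Var[of p j] by (auto simp: in_keys_iff)
qed

lemma prod_single:
  "(\<Prod>i\<in>I. Poly_Mapping.single (m i) (1::'k::field)) = Poly_Mapping.single (\<Sum>i\<in>I. m i) 1"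
  for m :: "'i \<Rightarrow> 'n \<Rightarrow>\<^sub>0 nat"
  by (induction I rule: infinite_finite_induct) (auto simp: mult_single)

text \<open>
  The multiple \<open>d m\<close> of an exponent vector is written as a repeated sum.
\<close>

lemma single_power:
  "Poly_Mapping.single m (1::'k::field) ^ d = Poly_Mapping.single (\<Sum>_<d. m) 1"
  for m :: "'n \<Rightarrow>\<^sub>0 nat"
  using prod_single[of "\<lambda>_. m" "{..<d}", where ?'k = 'k] by simp

lemma monomial_eq_single:
  fixes a :: "nat^'n::finite"
  obtains s where "(monomial a :: ('n, 'k::field) mpoly) = Poly_Mapping.single s 1"
    and "\<And>i. Poly_Mapping.lookup s i = a $ i"
proof
  show "(monomial a :: ('n, 'k) mpoly) =
      Poly_Mapping.single (\<Sum>i\<in>UNIV. \<Sum>_<a $ i. Poly_Mapping.single i 1) 1"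
    by (simp add: monomial_def Var_def single_power prod_single)
  show "Poly_Mapping.lookup (\<Sum>i\<in>UNIV. \<Sum>_<a $ i. Poly_Mapping.single i 1) l = a $ l" for l
    by (simp add: lookup_sum lookup_single when_def if_distrib[of "(*) _"] sum.delta cong: if_cong)
qed

text \<open>
  Substituting monomials into a term again gives a term, whose exponent vector is a combination of
  the substituted exponent vectors with the old exponents as coefficients. Distinct terms may cancel
  after the substitution, but no new exponents arise.
\<close>

lemma keys_subst_monomials:
  fixes p :: "('n::finite, 'k::field) mpoly"
  assumes "m \<in> Poly_Mapping.keys (subst (\<lambda>j. monomial (v j)) p)"
  obtains e :: "'n \<Rightarrow> nat" where "\<And>l. Poly_Mapping.lookup m l = (\<Sum>k\<in>UNIV. e k * v k $ l)"
proof -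
  have "\<exists>s. (monomial (v k) :: ('n, 'k) mpoly) = Poly_Mapping.single s 1 \<and>
      (\<forall>i. Poly_Mapping.lookup s i = v k $ i)" for k
    by (metis monomial_eq_single)
  then obtain s where s: "\<And>k. (monomial (v k) :: ('n, 'k) mpoly) = Poly_Mapping.single (s k) 1"
    and ls: "\<And>k i. Poly_Mapping.lookup (s k) i = v k $ i"
    by metis
  define t where "t e = (\<Sum>k\<in>UNIV. \<Sum>_<Poly_Mapping.lookup e k. s k)" for e :: "'n \<Rightarrow>\<^sub>0 nat"
  have "subst (\<lambda>j. monomial (v j)) p =
      (\<Sum>e\<in>Poly_Mapping.keys p. Poly_Mapping.single (t e) (Poly_Mapping.lookup p e))"
    by (simp add: subst_def Const_def s single_power prod_single mult_single t_def)
  with assms obtain e where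
    "m \<in> Poly_Mapping.keys (Poly_Mapping.single (t e) (Poly_Mapping.lookup p e))"
    using keys_sum by fastforce
  then have "m = t e" by (auto split: if_splits)
  then have "Poly_Mapping.lookup m l = (\<Sum>k\<in>UNIV. Poly_Mapping.lookup e k * v k $ l)" for l
    by (simp add: t_def lookup_sum ls)
  then show ?thesis by (rule that)
qed

text \<open>
  Let \<open>G\<^sub>j\<close> be the components of the composite of the monomial map with its inverse. It is the
  identity, so \<open>G\<^sub>i x\<^sub>j = G\<^sub>j x\<^sub>i\<close>. Multiplication by a variable translates the exponents, so an exponent
  \<open>m\<close> of \<open>G\<^sub>i\<close> yields the exponent \<open>m + e\<^sub>j - e\<^sub>i\<close> of \<open>G\<^sub>j\<close>; both are integral combinations of the \<open>v k\<close>,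
  and so is the difference \<open>e\<^sub>j - e\<^sub>i\<close>.
\<close>

lemma cremona_lattice:
  fixes v :: "'n::finite \<Rightarrow> nat^'n"
  assumes "cremona_set TYPE('k::field) v"
  obtains i :: 'n and c :: "'n \<Rightarrow> 'n \<Rightarrow> int"
  where "\<And>j l. (\<Sum>k\<in>UNIV. c j k * int (v k $ l)) = of_bool (l = j) - of_bool (l = i)"
proof -
  let ?f = "\<lambda>j. monomial (v j) :: ('n, 'k) mpoly"
  obtain g where "rational_map (comp_map g ?f)" and "same_map (comp_map g ?f) Var"
    using assms unfolding cremona_set_def birational_def by blast
  then obtain i where "subst ?f (g i) \<noteq> 0"
    and same: "\<And>j. subst ?f (g i) * Var j = subst ?f (g j) * Var i"
    unfolding rational_map_def same_map_def comp_map_def by blast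
  then obtain m where m: "m \<in> Poly_Mapping.keys (subst ?f (g i))"
    by (metis keys_eq_empty ex_in_conv)
  then obtain e where e: "\<And>l. Poly_Mapping.lookup m l = (\<Sum>k\<in>UNIV. e k * v k $ l)"
    using keys_subst_monomials by blast
  have "\<exists>c :: 'n \<Rightarrow> int. \<forall>l. (\<Sum>k\<in>UNIV. c k * int (v k $ l)) = of_bool (l = j) - of_bool (l = i)" for j
  proof -
    have "m + Poly_Mapping.single j 1 \<in> Poly_Mapping.keys (subst ?f (g j) * Var i)"
      using m unfolding same[symmetric] keys_times_Var by blast
    then obtain m' where m': "m' \<in> Poly_Mapping.keys (subst ?f (g j))"
      and eq: "m + Poly_Mapping.single j 1 = m' + Poly_Mapping.single i 1"
      unfolding keys_times_Var by blast
    obtain e' where e': "\<And>l. Poly_Mapping.lookup m' l = (\<Sum>k\<in>UNIV. e' k * v k $ l)"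
      using keys_subst_monomials[OF m'] by blast
    have diff: "(\<Sum>k\<in>UNIV. (int (e' k) - int (e k)) * int (v k $ l)) =
        of_bool (l = j) - of_bool (l = i)" for l
    proof -
      have "Poly_Mapping.lookup m l + of_bool (l = j) = Poly_Mapping.lookup m' l + of_bool (l = i)"
        using arg_cong[OF eq, of "\<lambda>q. Poly_Mapping.lookup q l"]
        by (simp add: lookup_add lookup_single when_def split: if_splits)
      then have "int (Poly_Mapping.lookup m l + of_bool (l = j)) =
          int (Poly_Mapping.lookup m' l + of_bool (l = i))" by (simp only:)
      then have "int (\<Sum>k\<in>UNIV. e k * v k $ l) + of_bool (l = j) =
          int (\<Sum>k\<in>UNIV. e' k * v k $ l) + of_bool (l = i)"
        unfolding e e' by (simp only: of_nat_add of_nat_of_bool)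
      then show ?thesis by (simp add: left_diff_distrib sum_subtractf)
    qed
    show ?thesis
      by (rule exI[of _ "\<lambda>k. int (e' k) - int (e k)"], rule allI, rule diff)
  qed
  then have "\<exists>c :: 'n \<Rightarrow> 'n \<Rightarrow> int. \<forall>j l.
      (\<Sum>k\<in>UNIV. c j k * int (v k $ l)) = of_bool (l = j) - of_bool (l = i)"
    by (intro choice allI)
  then show ?thesis using that by blast
qed

section \<open>The inverse set\<close>

text \<open>
  Independence over the integers, which is the same as over the rationals: the form in which the
  injectivity of the log-matrix is applied to integral vectors.
\<close>

definition lin_indep :: "('n::finite \<Rightarrow> nat^'n) \<Rightarrow> bool" where
  "lin_indep v \<longleftrightarrow>
     (\<forall>c :: 'n \<Rightarrow> int. (\<forall>l. (\<Sum>k\<in>UNIV. c k * int (v k $ l)) = 0) \<longrightarrow> (\<forall>k. c k = 0))"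

lemma sum_of_bool_diff:
  fixes f :: "'n::finite \<Rightarrow> 'a::comm_ring_1"
  shows "(\<Sum>j\<in>UNIV. f j * (of_bool (l = j) - of_bool (l = i))) = f l - of_bool (l = i) * sum f UNIV"
proof -
  have "(\<Sum>j\<in>UNIV. f j * of_bool (l = j)) = f l"
    by (simp add: of_bool_def sum.delta' if_distrib cong: if_cong)
  then show ?thesis by (simp add: right_diff_distrib sum_subtractf sum_distrib_right[symmetric] mult.commute)
qed

text \<open>
  A square matrix with a right inverse is injective. Besides the differences \<open>e\<^sub>j - e\<^sub>i\<close>, whose
  preimages are the \<open>c j\<close>, the vector \<open>e\<^sub>i\<close> itself has a rational preimage: any column \<open>v k\<close> of degree \<open>d\<close>
  equals \<open>d e\<^sub>i\<close> plus a combination of differences. This makes the right inverse explicit.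
\<close>

lemma lin_indep_of_differences:
  fixes v :: "'n::finite \<Rightarrow> nat^'n" and c :: "'n \<Rightarrow> 'n \<Rightarrow> int"
  assumes deg: "has_degree v d" and "d > 0"
    and c: "\<And>j l. (\<Sum>k\<in>UNIV. c j k * int (v k $ l)) = of_bool (l = j) - of_bool (l = i)"
  shows "lin_indep v"
proof -
  define A :: "real^'n^'n" where "A = (\<chi> l k. real (v k $ l))"
  define i0 :: 'n where "i0 = undefined"
  \<comment> \<open>The preimage of \<open>d e\<^sub>i\<close> obtained from the column with the arbitrary index \<open>i0\<close>.\<close>
  define s where "s k = (if k = i0 then 1 else 0) - (\<Sum>j\<in>UNIV. real (v i0 $ j) * of_int (c j k))" for k
  define B :: "real^'n^'n" where "B = (\<chi> k j. of_int (c j k) + s k / real d)"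
  have Ac: "(\<Sum>k\<in>UNIV. of_int (c j k) * real (v k $ l)) = of_bool (l = j) - of_bool (l = i)" for j l
    using arg_cong[OF c[of j l], of real_of_int] by simp
  have As: "(\<Sum>k\<in>UNIV. s k * real (v k $ l)) = d * of_bool (l = i)" for l
  proof -
    have "(\<Sum>k\<in>UNIV. s k * real (v k $ l)) = real (v i0 $ l) -
        (\<Sum>k\<in>UNIV. \<Sum>j\<in>UNIV. real (v i0 $ j) * of_int (c j k) * real (v k $ l))"
      by (simp add: s_def left_diff_distrib sum_subtractf sum_distrib_right if_distrib[of "\<lambda>x. x * _"] cong: if_cong)
    also have "(\<Sum>k\<in>UNIV. \<Sum>j\<in>UNIV. real (v i0 $ j) * of_int (c j k) * real (v k $ l)) =
        (\<Sum>j\<in>UNIV. real (v i0 $ j) * (\<Sum>k\<in>UNIV. of_int (c j k) * real (v k $ l)))"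
      by (subst sum.swap) (simp add: sum_distrib_left mult.assoc)
    also have "\<dots> = real (v i0 $ l) - of_bool (l = i) * (\<Sum>j\<in>UNIV. real (v i0 $ j))"
      unfolding Ac by (rule sum_of_bool_diff)
    also have "(\<Sum>j\<in>UNIV. real (v i0 $ j)) = d"
      using deg unfolding has_degree_def of_nat_sum[symmetric] by simp
    finally show ?thesis by simp
  qed
  have "A ** B = mat 1"
  proof (simp add: vec_eq_iff, intro allI)
    fix l j
    have "(A ** B) $ l $ j = (\<Sum>k\<in>UNIV. of_int (c j k) * real (v k $ l)) +
        (\<Sum>k\<in>UNIV. s k * real (v k $ l)) / d"
      by (simp add: matrix_matrix_mult_def A_def B_def distrib_left sum.distrib sum_divide_distrib mult.commute)
    also have "\<dots> = mat 1 $ l $ j" using \<open>d > 0\<close> by (simp add: Ac As mat_def)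
    finally show "(A ** B) $ l $ j = mat 1 $ l $ j" .
  qed
  then have BA: "B ** A = mat 1" by (simp add: matrix_left_right_inverse)
  show ?thesis unfolding lin_indep_def
  proof (intro allI impI)
    fix e :: "'n \<Rightarrow> int" and k
    assume e: "\<forall>l. (\<Sum>k\<in>UNIV. e k * int (v k $ l)) = 0"
    define x :: "real^'n" where "x = (\<chi> k. of_int (e k))"
    have "A *v x = 0"
    proof (simp add: vec_eq_iff, intro allI)
      fix l
      have "(A *v x) $ l = of_int (\<Sum>k\<in>UNIV. e k * int (v k $ l))"
        by (simp add: matrix_vector_mult_def A_def x_def mult.commute)
      then show "(A *v x) $ l = 0" using e by simp
    qed
    then have "x = 0" by (metis BA matrix_vector_mul_assoc matrix_vector_mul_lid matrix_vector_mult_0_right)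
    then show "e k = 0" by (simp add: x_def vec_eq_iff)
  qed
qed

lemma lin_indepD:
  fixes a b :: "'n::finite \<Rightarrow> int"
  assumes "lin_indep v"
    and "\<And>l. (\<Sum>k\<in>UNIV. a k * int (v k $ l)) = (\<Sum>k\<in>UNIV. b k * int (v k $ l))"
  shows "a k = b k"
proof -
  have "(\<Sum>k\<in>UNIV. (a k - b k) * int (v k $ l)) = 0" for l
    using assms(2)[of l] by (simp add: left_diff_distrib sum_subtractf)
  then have "a k - b k = 0"
    using assms(1)[unfolded lin_indep_def, rule_format, of "\<lambda>k. a k - b k"] by blast
  then show ?thesis by simp
qed

text \<open>
  The matrix equation \<open>A\<^sub>F A\<^sub>W = [\<gamma>| \<dots> |\<gamma>] + I\<close> entry by entry.
\<close>

definition shifted_inverse :: "('n::finite \<Rightarrow> nat^'n) \<Rightarrow> ('n \<Rightarrow> nat^'n) \<Rightarrow> nat^'n \<Rightarrow> bool" where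
  "shifted_inverse v w \<gamma> \<longleftrightarrow>
     (\<forall>j l. (\<Sum>k\<in>UNIV. w j $ k * v k $ l) = \<gamma> $ l + of_bool (l = j))"

lemma log_matrix_product_iff:
  "log_matrix v ** log_matrix w = (\<chi> i j. \<gamma> $ i) + mat 1 \<longleftrightarrow> shifted_inverse v w \<gamma>"
  by (auto simp: shifted_inverse_def log_matrix_def matrix_matrix_mult_def mat_def vec_eq_iff
      mult.commute of_bool_def)

lemma shifted_inverse_int:
  assumes "shifted_inverse v w \<gamma>"
  shows "(\<Sum>k\<in>UNIV. int (w j $ k) * int (v k $ l)) = int (\<gamma> $ l) + of_bool (l = j)"
proof -
  have "int (\<Sum>k\<in>UNIV. w j $ k * v k $ l) = int (\<gamma> $ l + of_bool (l = j))"
    using assms unfolding shifted_inverse_def by simp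
  then show ?thesis by simp
qed

lemma shifted_inverse_inj:
  assumes "shifted_inverse v w \<gamma>"
  shows "inj w"
proof (rule injI)
  fix i j assume eq: "w i = w j"
  have sum: "(\<Sum>k\<in>UNIV. w j $ k * v k $ i) = \<gamma> $ i + of_bool (i = j)" for j
    using assms unfolding shifted_inverse_def by blast
  show "i = j" using sum[of i] unfolding eq sum[of j] by (simp add: of_bool_def split: if_splits)
qed

text \<open>
  Combine the \<open>w j\<close> with the entries of \<open>v k - v m\<close> as coefficients, where \<open>m \<noteq> k\<close>. The log-matrix maps
  the result to \<open>v k - v m\<close>, the shift \<open>\<gamma>\<close> cancelling because both columns have the same degree, so by
  independence the result is \<open>e\<^sub>k - e\<^sub>m\<close>. Its entry at \<open>k\<close> is \<open>1\<close>, hence some \<open>w j\<close> involves \<open>k\<close>.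
\<close>

lemma shifted_inverse_every_variable:
  fixes v :: "'n::finite \<Rightarrow> nat^'n"
  assumes "CARD('n) \<ge> 2" and ind: "lin_indep v" and deg: "has_degree v d"
    and sh: "shifted_inverse v w \<gamma>"
  shows "\<exists>j. 1 \<le> w j $ k"
proof (rule ccontr)
  assume "\<not> ?thesis"
  then have zero: "w j $ k = 0" for j by (simp add: not_less_eq_eq)
  obtain m where "m \<noteq> k"
    using assms(1) by (metis card_2_iff' card_le_Suc0_iff_eq finite UNIV_I not_less_eq_eq numeral_2_eq_2)
  define D where "D q = (\<Sum>j\<in>UNIV. (int (v k $ j) - int (v m $ j)) * int (w j $ q))" for q
  have deg': "(\<Sum>j\<in>UNIV. int (v q $ j)) = int d" for q
    using deg unfolding has_degree_def of_nat_sum[symmetric] by simp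
  have "(\<Sum>q\<in>UNIV. D q * int (v q $ l)) =
      (\<Sum>q\<in>UNIV. (of_bool (q = k) - of_bool (q = m)) * int (v q $ l))" for l
  proof -
    have "(\<Sum>q\<in>UNIV. D q * int (v q $ l)) =
        (\<Sum>j\<in>UNIV. (int (v k $ j) - int (v m $ j)) * (\<Sum>q\<in>UNIV. int (w j $ q) * int (v q $ l)))"
      unfolding D_def sum_distrib_left sum_distrib_right
      by (subst sum.swap) (simp add: mult.assoc)
    also have "\<dots> = (\<Sum>j\<in>UNIV. (int (v k $ j) - int (v m $ j)) * int (\<gamma> $ l))
        + (\<Sum>j\<in>UNIV. (int (v k $ j) - int (v m $ j)) * of_bool (l = j))"
      unfolding shifted_inverse_int[OF sh] by (simp add: distrib_left sum.distrib)
    also have "\<dots> = int (v k $ l) - int (v m $ l)"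
      by (simp add: sum_distrib_right[symmetric] sum_subtractf deg' of_bool_def if_distrib cong: if_cong)
    also have "\<dots> = (\<Sum>q\<in>UNIV. (of_bool (q = k) - of_bool (q = m)) * int (v q $ l))"
      by (simp add: left_diff_distrib sum_subtractf of_bool_def if_distrib[of "\<lambda>x. x * _"] cong: if_cong)
    finally show ?thesis .
  qed
  then have "D k = of_bool (k = k) - of_bool (k = m)" by (rule lin_indepD[OF ind])
  then show False using zero \<open>m \<noteq> k\<close> by (simp add: D_def)
qed

lemma no_common_factor_iff:
  fixes w :: "'n::finite \<Rightarrow> nat^'n"
  shows "(\<forall>u. (\<forall>j. \<forall>i. u $ i \<le> w j $ i) \<longrightarrow> u = 0) \<longleftrightarrow> (\<forall>i. \<exists>j. w j $ i = 0)"
proof safe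
  fix i assume *: "\<forall>u::nat^'n. (\<forall>j i. u $ i \<le> w j $ i) \<longrightarrow> u = 0"
  show "\<exists>j. w j $ i = 0"
  proof (rule ccontr)
    assume "\<not> ?thesis"
    then have "\<forall>j l. axis i 1 $ l \<le> w j $ l" by (simp add: axis_def Suc_le_eq)
    then have "axis i (1::nat) = 0" using * by blast
    then show False by (simp add: axis_eq_0_iff)
  qed
next
  fix u :: "nat^'n" assume "\<forall>i. \<exists>j. w j $ i = 0" "\<forall>j i. u $ i \<le> w j $ i"
  then show "u = 0" by (metis le_zero_eq vec_eq_iff zero_index)
qed

text \<open>
  Two solutions of the matrix equation differ, by independence, by a vector that does not depend on
  the column. Adding a vector to all columns preserves the absence of a common factor, that is, the
  fact that every row has minimum \<open>0\<close>, only if the vector is \<open>0\<close>.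
\<close>

lemma inverse_set_eqI:
  fixes v :: "'n::finite \<Rightarrow> nat^'n"
  assumes "CARD('n) \<ge> 2" and ind: "lin_indep v" and deg: "has_degree v d"
    and sh: "shifted_inverse v w \<gamma>" and "has_degree w d'" and nocommon: "\<And>i. \<exists>j. w j $ i = 0"
  shows "is_inverse_set v w" "inverse_set v = w"
proof -
  show inv: "is_inverse_set v w"
    unfolding is_inverse_set_def monomial_set_def canonical_restrictions_def
      no_common_factor_iff log_matrix_product_iff
    using assms shifted_inverse_inj[OF sh] shifted_inverse_every_variable[OF assms(1) ind deg sh]
    by blast
  have "w' = w" if w': "is_inverse_set v w'" for w'
  proof -
    obtain \<gamma>' where sh': "shifted_inverse v w' \<gamma>'" and nocommon': "\<And>i. \<exists>j. w' j $ i = 0"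
      using w' unfolding is_inverse_set_def canonical_restrictions_def
        no_common_factor_iff log_matrix_product_iff by blast
    have diff: "int (w' j $ k) - int (w j $ k) = int (w' i $ k) - int (w i $ k)" for i j k
    proof (rule lin_indepD[OF ind])
      show "(\<Sum>k\<in>UNIV. (int (w' j $ k) - int (w j $ k)) * int (v k $ l)) =
          (\<Sum>k\<in>UNIV. (int (w' i $ k) - int (w i $ k)) * int (v k $ l))" for l
        by (simp add: left_diff_distrib sum_subtractf shifted_inverse_int[OF sh] shifted_inverse_int[OF sh'])
    qed
    have "w' j $ k = w j $ k" for j k
    proof -
      obtain a b where "w a $ k = 0" "w' b $ k = 0" using nocommon nocommon' by blast
      then show ?thesis using diff[of j k a] diff[of j k b] by linarith
    qed
    then show "w' = w" by (simp add: fun_eq_iff vec_eq_iff)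
  qed
  then show "inverse_set v = w" unfolding inverse_set_def using inv by (intro the_equality)
qed

text \<open>
  The integral preimages \<open>c j\<close> of \<open>e\<^sub>j - e\<^sub>i\<close>, normalized by subtracting from each row its minimum, form
  the inverse set.
\<close>

lemma is_inverse_set_inverse_set:
  fixes v :: "'n::finite \<Rightarrow> nat^'n" and c :: "'n \<Rightarrow> 'n \<Rightarrow> int"
  assumes "CARD('n) \<ge> 2" and deg: "has_degree v d" and "d > 0"
    and c: "\<And>j l. (\<Sum>k\<in>UNIV. c j k * int (v k $ l)) = of_bool (l = j) - of_bool (l = i)"
  shows "is_inverse_set v (inverse_set v)"
proof -
  define mn where "mn k = Min (range (\<lambda>j. c j k))" for k
  define w :: "'n \<Rightarrow> nat^'n" where "w j = (\<chi> k. nat (c j k - mn k))" for j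
  have w: "int (w j $ k) = c j k - mn k" for j k by (simp add: w_def mn_def)
  define g where "g l = - of_bool (l = i) - (\<Sum>k\<in>UNIV. mn k * int (v k $ l))" for l
  have ws: "(\<Sum>k\<in>UNIV. int (w j $ k) * int (v k $ l)) = g l + of_bool (l = j)" for j l
    unfolding w by (simp add: left_diff_distrib sum_subtractf c g_def)
  \<comment> \<open>A column \<open>j \<noteq> l\<close> exhibits \<open>g l\<close> as a sum of natural numbers.\<close>
  have "g l \<ge> 0" for l
  proof -
    obtain j where "j \<noteq> l"
      using assms(1) by (metis card_2_iff' card_le_Suc0_iff_eq finite UNIV_I not_less_eq_eq numeral_2_eq_2)
    then have "g l = (\<Sum>k\<in>UNIV. int (w j $ k) * int (v k $ l))" by (simp add: ws)
    also have "\<dots> \<ge> 0" by (intro sum_nonneg) simp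
    finally show ?thesis .
  qed
  then have sh: "shifted_inverse v w (\<chi> l. nat (g l))"
    unfolding shifted_inverse_def using ws
    by (simp flip: of_nat_eq_iff[where ?'a = int] add: of_bool_def)
  \<comment> \<open>Adding up the rows turns the factor \<open>v\<close> into the constant \<open>d\<close>, so the degrees of the \<open>w j\<close> agree.\<close>
  have "int d * (\<Sum>k\<in>UNIV. int (w j $ k)) = (\<Sum>l\<in>UNIV. g l) + 1" for j
  proof -
    \<comment> \<open>Adding up the rows turns the factor \<open>v\<close> into the constant \<open>d\<close>, so the degrees of the \<open>w j\<close> agree.\<close>
  have "int d * (\<Sum>k\<in>UNIV. int (w j $ k)) =
        (\<Sum>k\<in>UNIV. int (w j $ k) * int (\<Sum>l\<in>UNIV. v k $ l))"
      using deg unfolding has_degree_def by (simp add: sum_distrib_left mult.commute)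
    also have "\<dots> = (\<Sum>l\<in>UNIV. \<Sum>k\<in>UNIV. int (w j $ k) * int (v k $ l))"
      by (subst sum.swap) (simp add: sum_distrib_left)
    finally show ?thesis by (simp add: ws sum.distrib of_bool_def)
  qed
  then have "int d * int (\<Sum>k\<in>UNIV. w j $ k) = int d * int (\<Sum>k\<in>UNIV. w i $ k)" for j by simp
  then have "(\<Sum>k\<in>UNIV. w j $ k) = (\<Sum>k\<in>UNIV. w i $ k)" for j
    using \<open>d > 0\<close> by (simp del: of_nat_sum)
  then have "has_degree w (\<Sum>k\<in>UNIV. w i $ k)" by (simp add: has_degree_def)
  moreover have "\<exists>j. w j $ k = 0" for k
  proof -
    have "mn k \<in> range (\<lambda>j. c j k)" unfolding mn_def by (intro Min_in) auto
    then show ?thesis by (auto simp: w_def)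
  qed
  ultimately show ?thesis
    using inverse_set_eqI[OF assms(1) lin_indep_of_differences[OF deg \<open>d > 0\<close> c] deg sh] by simp
qed

section \<open>Connected graphs with as many edges as vertices\<close>

text \<open>
  Connectedness in terms of cuts: the form in which a parity argument yields it for \<open>G\<^sub>F\<close>, and in which
  it is seen to survive the deletion of an edge of a circuit.
\<close>

definition crossing_connected :: "'a set set \<Rightarrow> bool" where
  "crossing_connected E \<longleftrightarrow>
     (\<forall>S. S \<noteq> {} \<and> S \<noteq> UNIV \<longrightarrow> (\<exists>a\<in>S. \<exists>b. b \<notin> S \<and> {a, b} \<in> E))"

lemma crossing_edge:
  assumes "crossing_connected E" "x \<in> S" "y \<notin> S"
  obtains a b where "a \<in> S" "b \<notin> S" "{a, b} \<in> E"
  using assms unfolding crossing_connected_def by blast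

text \<open>
  Starting from one vertex, a connected graph is exhausted by adding crossing edges one at a time.
\<close>

lemma connected_imp_many_edges:
  fixes E :: "'a::finite set set"
  assumes "crossing_connected E"
  shows "CARD('a) \<le> card E + 1"
proof -
  have "1 \<le> k \<Longrightarrow> k \<le> CARD('a) \<Longrightarrow>
      \<exists>S::'a set. card S = k \<and> k \<le> card {e \<in> E. e \<subseteq> S} + 1" for k
  proof (induction k rule: nat_induct_at_least[of 1])
    case base
    then show ?case by (intro exI[of _ "{undefined}"]) simp
  next
    case (Suc k)
    then obtain S :: "'a set" where S: "card S = k" "k \<le> card {e \<in> E. e \<subseteq> S} + 1" by auto
    then obtain x y where "x \<in> S" "y \<notin> S"
      using Suc.hyps Suc.prems by (metis UNIV_eq_I card.empty not_less_eq_eq not_one_le_zero ex_in_conv le_refl)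
    then obtain a b where ab: "a \<in> S" "b \<notin> S" "{a, b} \<in> E"
      using crossing_edge[OF assms] by metis
    have "insert {a, b} {e \<in> E. e \<subseteq> S} \<subseteq> {e \<in> E. e \<subseteq> insert b S}"
      using ab by auto
    then have "card (insert {a, b} {e \<in> E. e \<subseteq> S}) \<le> card {e \<in> E. e \<subseteq> insert b S}"
      by (intro card_mono) auto
    moreover have "{a, b} \<notin> {e \<in> E. e \<subseteq> S}" using ab by auto
    ultimately show ?case using S ab by (intro exI[of _ "insert b S"]) auto
  qed
  from this[of "CARD('a)"] obtain S :: "'a set" where
    "CARD('a) \<le> card {e \<in> E. e \<subseteq> S} + 1" by (auto simp: Suc_le_eq)
  also have "\<dots> \<le> card E + 1" by (intro add_right_mono card_mono) auto
  finally show ?thesis .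
qed

definition cyclic_edges :: "'a list \<Rightarrow> 'a set set" where
  "cyclic_edges xs = {{xs ! k, xs ! (Suc k mod length xs)} | k. k < length xs}"

lemma is_circuit_iff:
  "is_circuit E C \<longleftrightarrow> C \<subseteq> E \<and>
     (\<exists>xs. distinct xs \<and> length xs \<ge> 1 \<and> length xs \<noteq> 2 \<and> C = cyclic_edges xs)"
  by (simp add: is_circuit_def cyclic_edges_def)

text \<open>
  Having crossed from one side of a cut to the other, a circuit has to come back: walking from one
  end of \<open>{a, b}\<close> along the rest of the circuit to the other end, one changes sides again.
\<close>

lemma circuit_crossed_twice:
  assumes C: "is_circuit E C" and "{a, b} \<in> C" "a \<in> S" "b \<notin> S"
  obtains a' b' where "{a', b'} \<in> C" "{a', b'} \<noteq> {a, b}" "a' \<in> S" "b' \<notin> S"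
proof -
  obtain xs where xs: "distinct xs" "length xs \<noteq> 2" and Cxs: "C = cyclic_edges xs"
    using C unfolding is_circuit_iff by blast
  define m where "m = length xs"
  obtain k where k: "k < m" and abk: "{a, b} = {xs ! k, xs ! (Suc k mod m)}"
    using assms(2) unfolding Cxs cyclic_edges_def m_def by blast
  \<comment> \<open>The list rotated to start right after the edge \<open>{a, b}\<close>.\<close>
  define y where "y t = xs ! ((Suc k + t) mod m)" for t
  have m: "m > 0" using k by simp
  have y0: "y 0 = xs ! (Suc k mod m)" by (simp add: y_def)
  have "Suc k + (m - 1) = k + m" using m by simp
  then have ym: "y (m - 1) = xs ! k" using k by (simp add: y_def)
  have ends: "{a, b} = {y 0, y (m - 1)}" using abk y0 ym by auto
  have step: "{y t, y (Suc t)} \<in> C" for t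
  proof -
    have "(Suc k + t) mod m < m" using m by simp
    moreover have "(Suc k + Suc t) mod m = Suc ((Suc k + t) mod m) mod m"
      by (simp add: mod_Suc_eq)
    ultimately show ?thesis unfolding Cxs cyclic_edges_def y_def m_def by auto
  qed
  have inj: "s = t" if "y s = y t" "s < m" "t < m" for s t
  proof -
    have "(Suc k + s) mod m = (Suc k + t) mod m"
      using that m xs(1) by (simp add: y_def m_def nth_eq_iff_index_eq)
    moreover have "(Suc k + s) mod m \<noteq> (Suc k + t) mod m" if "s < t" "t < m" for s t
    proof
      assume "(Suc k + s) mod m = (Suc k + t) mod m"
      then have "m dvd t - s" using that mod_eq_dvd_iff_nat[of "Suc k + s" "Suc k + t" m] by simp
      then show False using that by (auto dest: dvd_imp_le)
    qed
    ultimately show "s = t" using that(2,3) by (metis linorder_neqE_nat)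
  qed
  have diff: "(y 0 \<in> S) \<noteq> (y (m - 1) \<in> S)" using ends assms(3,4) by (auto simp: doubleton_eq_iff)
  have "\<exists>t<m - 1. (y t \<in> S) \<noteq> (y (Suc t) \<in> S)"
  proof (rule ccontr)
    assume not: "\<not> ?thesis"
    have "t \<le> m - 1 \<Longrightarrow> (y t \<in> S) = (y 0 \<in> S)" for t
      using not by (induction t) auto
    from this[of "m - 1"] show False using diff by blast
  qed
  then obtain t where t: "t < m - 1" "(y t \<in> S) \<noteq> (y (Suc t) \<in> S)" by blast
  have "{y t, y (Suc t)} \<noteq> {a, b}"
  proof
    assume "{y t, y (Suc t)} = {a, b}"
    then have "(y t = y 0 \<and> y (Suc t) = y (m - 1)) \<or> (y t = y (m - 1) \<and> y (Suc t) = y 0)"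
      unfolding ends by (auto simp: doubleton_eq_iff)
    then have "m = 2"
    proof
      assume "y t = y 0 \<and> y (Suc t) = y (m - 1)"
      then have "t = 0" "Suc t = m - 1" using inj[of t 0] inj[of "Suc t" "m - 1"] t(1) by simp_all
      then show "m = 2" by simp
    next
      assume "y t = y (m - 1) \<and> y (Suc t) = y 0"
      then have "t = m - 1" using inj[of t "m - 1"] t(1) by simp
      then show "m = 2" using t(1) by simp
    qed
    then show False using xs(2) m_def by simp
  qed
  then show ?thesis
    using t(2) step[of t] that[of "y t" "y (Suc t)"] that[of "y (Suc t)" "y t"]
    by (auto simp: insert_commute)
qed

lemma connected_delete_circuit_edge:
  assumes con: "crossing_connected E" and C: "is_circuit E C" and e: "e \<in> C"
  shows "crossing_connected (E - {e})"
  unfolding crossing_connected_def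
proof (intro allI impI)
  fix S :: "'a set" assume S: "S \<noteq> {} \<and> S \<noteq> UNIV"
  then obtain a b where ab: "a \<in> S" "b \<notin> S" "{a, b} \<in> E"
    using con unfolding crossing_connected_def by blast
  show "\<exists>a\<in>S. \<exists>b. b \<notin> S \<and> {a, b} \<in> E - {e}"
  proof (cases "{a, b} = e")
    case True
    then obtain a' b' where "{a', b'} \<in> C" "{a', b'} \<noteq> e" "a' \<in> S" "b' \<notin> S"
      using circuit_crossed_twice[OF C _ ab(1,2)] e by metis
    then show ?thesis using C unfolding is_circuit_def by blast
  qed (use ab in blast)
qed

lemma circuit_nonempty: "is_circuit E C \<Longrightarrow> C \<noteq> {}"
  unfolding is_circuit_iff cyclic_edges_def by fastforce

text \<open>
  If \<open>e\<close> lies on the circuit \<open>C\<close> but not on \<open>D\<close>, then \<open>e\<close> and afterwards an edge of \<open>D\<close> can be deleted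
  without disconnecting the graph, which leaves too few edges.
\<close>

lemma circuit_unique:
  fixes E :: "'a::finite set set"
  assumes con: "crossing_connected E" and card: "card E = CARD('a)"
    and C: "is_circuit E C" and D: "is_circuit E D"
  shows "C = D"
proof -
  have "C \<subseteq> D" if C: "is_circuit E C" and D: "is_circuit E D" for C D
  proof
    fix e assume e: "e \<in> C"
    show "e \<in> D"
    proof (rule ccontr)
      assume "e \<notin> D"
      then have D': "is_circuit (E - {e}) D" using D unfolding is_circuit_def by blast
      obtain f where f: "f \<in> D" using circuit_nonempty[OF D] by blast
      have ef: "e \<in> E" "f \<in> E" "e \<noteq> f"
        using C D e f \<open>e \<notin> D\<close> unfolding is_circuit_def by blast+
      have "crossing_connected (E - {e} - {f})"
        using connected_delete_circuit_edge[OF connected_delete_circuit_edge[OF con C e] D' f] .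
      then have "CARD('a) \<le> card (E - {e} - {f}) + 1" by (rule connected_imp_many_edges)
      moreover have "card E = Suc (card (E - {e}))" "card (E - {e}) = Suc (card (E - {e} - {f}))"
        using card.remove[OF finite, of e E] card.remove[OF finite, of f "E - {e}"] ef by blast+
      ultimately show False using card by simp
    qed
  qed
  then show ?thesis using C D by blast
qed

lemma cyclic_edges_image:
  "cyclic_edges xs = (\<lambda>k. {xs ! k, xs ! (Suc k mod length xs)}) ` {..<length xs}"
  unfolding cyclic_edges_def by blast

lemma card_cyclic_edges:
  assumes xs: "distinct xs" "length xs \<noteq> 2"
  shows "card (cyclic_edges xs) = length xs"
proof -
  define m where "m = length xs"
  have "inj_on (\<lambda>k. {xs ! k, xs ! (Suc k mod m)}) {..<m}"
  proof (rule inj_onI)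
    fix k l assume kl: "k \<in> {..<m}" "l \<in> {..<m}"
      and eq: "{xs ! k, xs ! (Suc k mod m)} = {xs ! l, xs ! (Suc l mod m)}"
    have lt: "Suc k mod m < m" "Suc l mod m < m" using kl by auto
    have "k = l \<or> (k = Suc l mod m \<and> l = Suc k mod m)"
      using eq kl lt xs(1) by (auto simp: doubleton_eq_iff m_def nth_eq_iff_index_eq)
    then show "k = l"
      using kl xs(2) by (auto simp: mod_Suc m_def split: if_splits)
  qed
  then have "card ((\<lambda>k. {xs ! k, xs ! (Suc k mod m)}) ` {..<m}) = m"
    by (simp add: card_image)
  then show ?thesis by (simp add: cyclic_edges_image m_def)
qed

lemma is_circuit_loop_iff: "is_circuit E C \<and> card C = 1 \<longleftrightarrow> (\<exists>a. {a} \<in> E \<and> C = {{a}})"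
proof
  assume "is_circuit E C \<and> card C = 1"
  then obtain xs where "C \<subseteq> E" "C = cyclic_edges xs" "length xs = 1"
    unfolding is_circuit_iff using card_cyclic_edges by metis
  then show "\<exists>a. {a} \<in> E \<and> C = {{a}}"
    by (auto simp: cyclic_edges_def length_Suc_conv)
next
  assume "\<exists>a. {a} \<in> E \<and> C = {{a}}"
  then obtain a where a: "{a} \<in> E" "C = {{a}}" by blast
  have "cyclic_edges [a] = {{a}}" by (auto simp: cyclic_edges_def)
  then have "distinct [a] \<and> length [a] \<ge> 1 \<and> length [a] \<noteq> 2 \<and> C = cyclic_edges [a]"
    using a by simp
  then show "is_circuit E C \<and> card C = 1"
    unfolding is_circuit_iff using a by (metis card_1_singleton_iff One_nat_def empty_subsetI insert_subset)
qed

lemma cyclic_edges_triangle: "cyclic_edges [a, b, c] = {{a, b}, {b, c}, {a, c}}"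
proof -
  have "{..<length [a, b, c]} = {0, 1, 2}" by auto
  then show ?thesis unfolding cyclic_edges_image by (auto simp: insert_commute)
qed

lemma is_circuit_triangle_iff:
  "is_circuit E C \<and> card C = 3 \<longleftrightarrow>
    (\<exists>a b c. distinct [a, b, c] \<and> C = {{a, b}, {b, c}, {a, c}} \<and> C \<subseteq> E)"
proof
  assume "is_circuit E C \<and> card C = 3"
  then obtain xs where xs: "C \<subseteq> E" "C = cyclic_edges xs" "length xs = 3" "distinct xs"
    unfolding is_circuit_iff using card_cyclic_edges by metis
  then obtain a b c where "xs = [a, b, c]" by (auto simp: length_Suc_conv numeral_3_eq_3)
  then show "\<exists>a b c. distinct [a, b, c] \<and> C = {{a, b}, {b, c}, {a, c}} \<and> C \<subseteq> E"
    using xs cyclic_edges_triangle by metis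
next
  assume "\<exists>a b c. distinct [a, b, c] \<and> C = {{a, b}, {b, c}, {a, c}} \<and> C \<subseteq> E"
  then obtain a b c where "distinct [a, b, c]" "C = cyclic_edges [a, b, c]" "C \<subseteq> E"
    using cyclic_edges_triangle by metis
  then show "is_circuit E C \<and> card C = 3"
    using card_cyclic_edges[of "[a, b, c]"] unfolding is_circuit_iff
    by (auto intro!: exI[of _ "[a, b, c]"])
qed

text \<open>
  The first vertex of a longest path has two neighbours on the path; the one further along closes a
  circuit with the segment leading to it.
\<close>

lemma circuit_of_min_degree_two:
  fixes F :: "'a::finite set set"
  assumes graph: "\<And>e. e \<in> F \<Longrightarrow> e \<subseteq> S \<and> (\<exists>a b. e = {a, b})" and "S \<noteq> {}"
    and noloop: "\<And>x. {x} \<notin> F"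
    and deg: "\<And>x. x \<in> S \<Longrightarrow> 2 \<le> card {e \<in> F. x \<in> e}"
  shows "\<exists>C. is_circuit F C"
proof -
  define path where "path xs \<longleftrightarrow> xs \<noteq> [] \<and> distinct xs \<and> set xs \<subseteq> S \<and>
    (\<forall>i. Suc i < length xs \<longrightarrow> {xs ! i, xs ! Suc i} \<in> F)" for xs
  obtain s where "s \<in> S" using \<open>S \<noteq> {}\<close> by blast
  then have "path [s]" by (simp add: path_def)
  moreover have "length xs < Suc (card S)" if "path xs" for xs
    using that by (metis path_def distinct_card card_mono finite le_imp_less_Suc)
  ultimately obtain xs where xs: "path xs" and max: "\<And>ys. path ys \<Longrightarrow> length ys \<le> length xs"
    using ex_has_greatest_nat[of path "[s]" length "Suc (card S)"] by (auto simp: less_Suc_eq_le)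
  define x where "x = xs ! 0"
  have xS: "x \<in> S" using xs by (auto simp: path_def x_def)
  \<comment> \<open>By maximality no neighbour of the first vertex is off the path.\<close>
  have on_path: "y \<in> set xs" if "{x, y} \<in> F" for y
  proof (rule ccontr)
    assume "y \<notin> set xs"
    moreover have "y \<in> S" using graph[OF that] by blast
    ultimately have "path (y # xs)"
      using xs that by (auto simp: path_def x_def nth_Cons insert_commute split: nat.splits)
    then show False using max[of "y # xs"] by simp
  qed
  obtain e f where ef: "e \<in> F" "f \<in> F" "x \<in> e" "x \<in> f" "e \<noteq> f"
    using deg[OF xS] by (auto simp: numeral_2_eq_2 card_le_Suc_iff)
  have "\<exists>y. e = {x, y}" if "e \<in> F" "x \<in> e" for e
    using graph[OF that(1)] that(2) by blast
  then obtain y z where yz: "e = {x, y}" "f = {x, z}" using ef by meson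
  have idx: "\<exists>i. 0 < i \<and> i < length xs \<and> xs ! i = y" if "{x, y} \<in> F" for y
  proof -
    have "x \<noteq> y" using noloop that by auto
    then show ?thesis using on_path[OF that] unfolding in_set_conv_nth x_def by (metis gr0I)
  qed
  obtain i j where ij: "0 < i" "i < length xs" "xs ! i = y" "0 < j" "j < length xs" "xs ! j = z"
    using idx[of y] idx[of z] ef yz by auto
  have "i \<noteq> j" using ij ef(5) yz by auto
  then obtain k where k: "2 \<le> k" "k < length xs" "{x, xs ! k} \<in> F"
  proof (cases "2 \<le> i")
    case True
    then show ?thesis using that[of i] ij ef(1) yz by simp
  next
    case False
    then have "2 \<le> j" using ij \<open>i \<noteq> j\<close> by linarith
    then show ?thesis using that[of j] ij ef(2) yz by simp
  qed
  define ys where "ys = take (Suc k) xs"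
  have ys: "length ys = Suc k" "distinct ys" using k xs by (auto simp: ys_def path_def)
  have "{ys ! l, ys ! (Suc l mod Suc k)} \<in> F" if "l < Suc k" for l
  proof (cases "l = k")
    case True
    then show ?thesis using k by (simp add: ys_def x_def insert_commute)
  next
    case False
    then show ?thesis using that k xs by (simp add: ys_def path_def)
  qed
  then have "cyclic_edges ys \<subseteq> F" unfolding cyclic_edges_def ys by blast
  then have "is_circuit F (cyclic_edges ys)" unfolding is_circuit_iff using ys k by auto
  then show ?thesis ..
qed

lemma is_circuit_mono: "is_circuit F C \<Longrightarrow> F \<subseteq> E \<Longrightarrow> is_circuit E C"
  unfolding is_circuit_def by blast

text \<open>
  Deleting a vertex with at most one edge keeps the number of edges at least as large as that of
  vertices, so a subgraph of minimal degree two is reached unless a loop has been met.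
\<close>

lemma circuit_of_many_edges:
  fixes F :: "'a::finite set set"
  assumes "\<And>e. e \<in> F \<Longrightarrow> e \<subseteq> S \<and> (\<exists>a b. e = {a, b})" and "S \<noteq> {}" and "card S \<le> card F"
  shows "\<exists>C. is_circuit F C"
  using assms
proof (induction "card S" arbitrary: S F)
  case 0
  then show ?case by simp
next
  case (Suc n)
  consider x where "{x} \<in> F"
    | "\<And>x. {x} \<notin> F" "\<And>x. x \<in> S \<Longrightarrow> 2 \<le> card {e \<in> F. x \<in> e}"
    | x where "\<And>x. {x} \<notin> F" "x \<in> S" "card {e \<in> F. x \<in> e} \<le> 1"
    by fastforce
  then show ?case
  proof cases
    case 1
    then show ?thesis using is_circuit_loop_iff[of F "{{x}}"] by blast
  next
    case 2
    then show ?thesis using circuit_of_min_degree_two[of F S] Suc.prems by blast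
  next
    case (3 x)
    define F' where "F' = {e \<in> F. x \<notin> e}"
    have "F = F' \<union> {e \<in> F. x \<in> e}" "F' \<inter> {e \<in> F. x \<in> e} = {}" by (auto simp: F'_def)
    then have "card F = card F' + card {e \<in> F. x \<in> e}" by (metis card_Un_disjoint finite)
    then have card: "card (S - {x}) \<le> card F'" using Suc.prems(3) 3 by simp
    have "S - {x} \<noteq> {}"
    proof
      assume "S - {x} = {}"
      then have "S = {x}" using 3 by blast
      then have "F \<subseteq> {{x}}" using Suc.prems(1) by fastforce
      then have "F = {}" using 3(1) by blast
      then show False using Suc.prems(3) \<open>S = {x}\<close> by simp
    qed
    moreover have "n = card (S - {x})" using Suc.hyps(2) 3 by simp
    moreover have "\<And>e. e \<in> F' \<Longrightarrow> e \<subseteq> S - {x} \<and> (\<exists>a b. e = {a, b})"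
      using Suc.prems(1) by (auto simp: F'_def)
    ultimately have "\<exists>C. is_circuit F' C" using Suc.hyps(1) card by blast
    then show ?thesis using is_circuit_mono[of F' _ F] by (auto simp: F'_def)
  qed
qed

lemma the_circuit_eq:
  fixes E :: "'a::finite set set"
  assumes "crossing_connected E" "card E = CARD('a)" "is_circuit E C"
  shows "the_circuit E = C"
  unfolding the_circuit_def
  using assms(3) circuit_unique[OF assms(1,2) _ assms(3)] by (rule the_equality)

lemma is_circuit_the_circuit:
  fixes E :: "'a::finite set set"
  assumes "crossing_connected E" "card E = CARD('a)" "\<And>e. e \<in> E \<Longrightarrow> \<exists>a b. e = {a, b}"
  shows "is_circuit E (the_circuit E)"
proof -
  obtain C where "is_circuit E C" using circuit_of_many_edges[of E UNIV] assms by auto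
  then show ?thesis using the_circuit_eq[OF assms(1,2)] by simp
qed

section \<open>The graph of a set of monomials of degree two\<close>

lemma axis_pair_sum:
  "(\<Sum>k\<in>UNIV. (axis x (1::nat) + axis y 1 :: nat^'n::finite) $ k * f k) = f x + f y"
  by (simp add: axis_def distrib_right sum.distrib if_distrib[of "\<lambda>x. x * _"] cong: if_cong)

lemma axis_nth_of_bool: "axis x (Suc 0) $ l = of_bool (l = x)"
  by (auto simp: axis_def)

lemma axis_pair_eq_iff:
  "axis x (1::nat) + axis y 1 = axis x' 1 + (axis y' 1 :: nat^'n::finite) \<longleftrightarrow> {x, y} = {x', y'}"
proof
  assume "axis x (1::nat) + axis y 1 = axis x' 1 + (axis y' 1 :: nat^'n)"
  then have "of_bool (l = x) + of_bool (l = y) = (of_bool (l = x') + of_bool (l = y') :: nat)" for l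
    by (simp add: vec_eq_iff axis_nth_of_bool)
  then have "l = x \<or> l = y \<longleftrightarrow> l = x' \<or> l = y'" for l
    by (smt (verit) add_is_0 of_bool_eq_0_iff)
  then show "{x, y} = {x', y'}" by blast
qed (auto simp: doubleton_eq_iff add.commute)

lemma vec_degree_Suc:
  fixes u :: "nat^'n::finite"
  assumes "(\<Sum>i\<in>UNIV. u $ i) = Suc d"
  obtains x u' where "u = axis x 1 + u'" "(\<Sum>i\<in>UNIV. u' $ i) = d"
proof -
  obtain x where x: "u $ x \<noteq> 0" using assms by (metis sum.neutral nat.distinct(1))
  define u' where "u' = (\<chi> i. if i = x then u $ i - 1 else u $ i)"
  have u: "u = axis x 1 + u'" using x by (auto simp: vec_eq_iff u'_def axis_def)
  moreover have "(\<Sum>i\<in>UNIV. u $ i) = 1 + (\<Sum>i\<in>UNIV. u' $ i)"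
    unfolding u by (simp add: sum.distrib axis_def)
  ultimately show ?thesis using that assms by simp
qed

lemma vec_degree_zero:
  "(\<Sum>i\<in>UNIV. u $ i) = 0 \<Longrightarrow> u = (0 :: nat^'n::finite)"
  by (simp add: vec_eq_iff)

lemma vec_degree_two:
  assumes "(\<Sum>i\<in>UNIV. (u::nat^'n::finite) $ i) = 2"
  obtains x y where "u = axis x 1 + axis y 1"
  using assms vec_degree_Suc[of u 1] vec_degree_Suc[where ?'n = 'n and d = 0] vec_degree_zero
  by (metis One_nat_def Suc_1 add.right_neutral)

lemma vec_degree_three:
  assumes "(\<Sum>i\<in>UNIV. (u::nat^'n::finite) $ i) = 3"
  obtains x y z where "u = axis x 1 + axis y 1 + axis z 1"
proof -
  obtain x u' where "u = axis x 1 + u'" "(\<Sum>i\<in>UNIV. u' $ i) = 2"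
    using vec_degree_Suc[of u 2] assms by auto
  then show ?thesis using vec_degree_two[of u'] that by (metis add.assoc)
qed

lemma graph_edges_iff: "{x, y} \<in> graph_edges v \<longleftrightarrow> axis x 1 + axis y 1 \<in> range v"
  unfolding graph_edges_def using axis_pair_eq_iff by (smt (verit) mem_Collect_eq)

lemma graph_edges_doubleton: "e \<in> graph_edges v \<Longrightarrow> \<exists>x y. e = {x, y}"
  unfolding graph_edges_def by blast

lemma card_graph_edges:
  fixes v :: "'n::finite \<Rightarrow> nat^'n"
  assumes "inj v" "has_degree v 2"
  shows "card (graph_edges v) = CARD('n)"
proof -
  define supp where "supp u = {i. u $ i \<noteq> 0}" for u :: "nat^'n"
  have supp: "supp (axis x 1 + axis y 1) = {x, y}" for x y :: 'n
    by (auto simp: supp_def axis_def)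
  have pair: "\<exists>x y. v k = axis x 1 + axis y 1" for k
    using assms(2) vec_degree_two[of "v k"] unfolding has_degree_def by metis
  have "inj (\<lambda>k. supp (v k))"
  proof (rule injI)
    fix k l assume "supp (v k) = supp (v l)"
    then have "v k = v l" using pair[of k] pair[of l] axis_pair_eq_iff supp by metis
    then show "k = l" using assms(1) by (simp add: inj_eq)
  qed
  moreover have "graph_edges v = range (\<lambda>k. supp (v k))"
  proof (intro set_eqI iffI)
    fix e assume "e \<in> graph_edges v"
    then obtain x y k where "e = {x, y}" "v k = axis x 1 + axis y 1"
      unfolding graph_edges_def by auto
    then show "e \<in> range (\<lambda>k. supp (v k))" using supp by (metis rangeI)
  next
    fix e assume "e \<in> range (\<lambda>k. supp (v k))"
    then obtain k where k: "e = supp (v k)" by blast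
    obtain x y where "v k = axis x 1 + axis y 1" using pair by blast
    then show "e \<in> graph_edges v" using k supp graph_edges_iff by (metis rangeI)
  qed
  ultimately show ?thesis by (simp add: card_image)
qed

lemma graph_edges_no_common_vertex:
  fixes v :: "'n::finite \<Rightarrow> nat^'n"
  assumes deg: "has_degree v 2" and can: "canonical_restrictions v"
  shows "\<exists>e\<in>graph_edges v. x \<notin> e"
proof -
  obtain k where k: "v k $ x = 0"
    using can unfolding canonical_restrictions_def no_common_factor_iff by blast
  obtain a b where ab: "v k = axis a 1 + axis b 1"
    using deg vec_degree_two[of "v k"] unfolding has_degree_def by metis
  have "{a, b} \<in> graph_edges v" unfolding graph_edges_iff ab[symmetric] by (rule rangeI)
  moreover have "x \<notin> {a, b}" using k unfolding ab by (auto simp: axis_def)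
  ultimately show ?thesis by (rule bexI[rotated])
qed

text \<open>
  If no edge crossed the cut \<open>S\<close>, every column of the log-matrix would have an even sum over \<open>S\<close>. But
  \<open>e\<^sub>x - e\<^sub>y\<close>, with \<open>x\<close> inside and \<open>y\<close> outside of \<open>S\<close>, is an integral combination of columns and has sum \<open>1\<close>.
\<close>

lemma graph_connected:
  fixes v :: "'n::finite \<Rightarrow> nat^'n" and c :: "'n \<Rightarrow> 'n \<Rightarrow> int"
  assumes deg: "has_degree v 2"
    and c: "\<And>j l. (\<Sum>k\<in>UNIV. c j k * int (v k $ l)) = of_bool (l = j) - of_bool (l = i)"
  shows "crossing_connected (graph_edges v)"
  unfolding crossing_connected_def
proof (intro allI impI)
  fix S :: "'n set" assume "S \<noteq> {} \<and> S \<noteq> UNIV"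
  then obtain x y where xy: "x \<in> S" "y \<notin> S" by blast
  show "\<exists>a\<in>S. \<exists>b. b \<notin> S \<and> {a, b} \<in> graph_edges v"
  proof (rule ccontr)
    assume no: "\<not> ?thesis"
    have even: "even (\<Sum>l\<in>S. int (v k $ l))" for k
    proof -
      obtain a b where ab: "v k = axis a 1 + axis b 1"
        using deg vec_degree_two[of "v k"] unfolding has_degree_def by metis
      then have "{a, b} \<in> graph_edges v" "{b, a} \<in> graph_edges v"
        by (metis graph_edges_iff rangeI insert_commute)+
      then have "a \<in> S \<longleftrightarrow> b \<in> S" using no by blast
      moreover have "(\<Sum>l\<in>S. int (v k $ l)) = of_bool (a \<in> S) + of_bool (b \<in> S)"
        by (simp add: ab axis_def sum.distrib if_distrib[of int] cong: if_cong)
      ultimately show ?thesis by simp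
    qed
    have "even (\<Sum>k\<in>UNIV. (c x k - c y k) * (\<Sum>l\<in>S. int (v k $ l)))"
      using even by (intro dvd_sum) simp
    also have "(\<Sum>k\<in>UNIV. (c x k - c y k) * (\<Sum>l\<in>S. int (v k $ l))) =
        (\<Sum>l\<in>S. \<Sum>k\<in>UNIV. (c x k - c y k) * int (v k $ l))"
      unfolding sum_distrib_left by (rule sum.swap)
    also have "\<dots> = (\<Sum>l\<in>S. of_bool (l = x) - of_bool (l = y))"
      by (simp add: left_diff_distrib sum_subtractf c)
    also have "\<dots> = 1" using xy by (simp add: sum_subtractf of_bool_def)
    finally show False by simp
  qed
qed

section \<open>Graphs of sets whose inverse has degree two\<close>

lemma axis_triple_eq_cases:
  assumes "axis x (1::nat) + (axis y 1 + axis z 1) = axis a 1 + axis b 1 + (axis c 1 :: nat^'n::finite)"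
  shows "(x = a \<and> {y, z} = {b, c}) \<or> (x = b \<and> {y, z} = {a, c}) \<or> (x = c \<and> {y, z} = {a, b})"
proof -
  have "x = a \<or> x = b \<or> x = c"
    using arg_cong[OF assms, of "\<lambda>u. u $ x"] by (auto simp: axis_nth_of_bool of_bool_def split: if_splits)
  then show ?thesis
  proof (elim disjE)
    assume "x = a"
    then have "axis y (1::nat) + axis z 1 = axis b 1 + (axis c 1 :: nat^'n)"
      using assms by (simp add: add.assoc)
    then have "{y, z} = {b, c}" by (simp only: axis_pair_eq_iff)
    then show ?thesis using \<open>x = a\<close> by blast
  next
    assume "x = b"
    then have "axis b 1 + (axis y (1::nat) + axis z 1) = axis b 1 + (axis a 1 + (axis c 1 :: nat^'n))"
      using assms by (simp add: ac_simps)
    then have "axis y (1::nat) + axis z 1 = axis a 1 + (axis c 1 :: nat^'n)"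
      by (rule add_left_imp_eq)
    then have "{y, z} = {a, c}" by (simp only: axis_pair_eq_iff)
    then show ?thesis using \<open>x = b\<close> by blast
  next
    assume "x = c"
    then have "axis c 1 + (axis y (1::nat) + axis z 1) = axis c 1 + (axis a 1 + (axis b 1 :: nat^'n))"
      using assms by (simp add: ac_simps)
    then have "axis y (1::nat) + axis z 1 = axis a 1 + (axis b 1 :: nat^'n)"
      by (rule add_left_imp_eq)
    then have "{y, z} = {a, b}" by (simp only: axis_pair_eq_iff)
    then show ?thesis using \<open>x = c\<close> by blast
  qed
qed

text \<open>
  In terms of exponent vectors: \<open>e\<^sub>a + e\<^sub>b + e\<^sub>c + e\<^sub>j\<close> is a sum of two edges, which may be loops and may
  coincide.
\<close>

definition splits_off :: "'a set set \<Rightarrow> 'a \<Rightarrow> 'a \<Rightarrow> 'a \<Rightarrow> 'a \<Rightarrow> bool" where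
  "splits_off E a b c j \<longleftrightarrow> ({j, a} \<in> E \<and> {b, c} \<in> E) \<or> ({j, b} \<in> E \<and> {a, c} \<in> E) \<or>
     ({j, c} \<in> E \<and> {a, b} \<in> E)"

lemma edge_pair_splits_off:
  assumes eq: "axis p (1::nat) + axis q 1 + (axis p' 1 + axis q' 1) =
      axis a 1 + axis b 1 + axis c 1 + (axis j 1 :: nat^'n::finite)"
    and E: "{p, q} \<in> E" "{p', q'} \<in> E"
  shows "splits_off E a b c j"
proof -
  have *: ?thesis if "axis j 1 + (axis y (1::nat) + (axis z 1 + axis z' 1)) =
      axis j 1 + (axis a 1 + axis b 1 + (axis c 1 :: nat^'n))"
    "{j, y} \<in> E" "{z, z'} \<in> E" for y z z'
    using axis_triple_eq_cases[OF add_left_imp_eq[OF that(1)]] that(2,3)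
    unfolding splits_off_def by metis
  have "j = p \<or> j = q \<or> j = p' \<or> j = q'"
    using arg_cong[OF eq, of "\<lambda>u. u $ j"] by (auto simp: axis_nth_of_bool of_bool_def split: if_splits)
  then show ?thesis
  proof (elim disjE)
    assume "j = p" then show ?thesis using *[of q p' q'] eq E by (simp add: ac_simps)
  next
    assume "j = q" then show ?thesis using *[of p p' q'] eq E by (simp add: ac_simps insert_commute)
  next
    assume "j = p'" then show ?thesis using *[of q' p q] eq E by (simp add: ac_simps)
  next
    assume "j = q'" then show ?thesis using *[of p' p q] eq E by (simp add: ac_simps insert_commute)
  qed
qed

text \<open>
  Summing the \<open>j\<close>th column of \<open>A\<^sub>F A\<^sub>W = [\<gamma>| \<dots> |\<gamma>] + I\<close> gives \<open>2 \<cdot> 2 = \<bar>\<gamma>\<bar> + 1\<close>, so \<open>\<gamma> = e\<^sub>a + e\<^sub>b + e\<^sub>c\<close>. As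
  \<open>w j\<close> has degree two, the column itself says that \<open>\<gamma> + e\<^sub>j\<close> is a sum of two columns of \<open>A\<^sub>F\<close>, that is,
  of two edges.
\<close>

lemma inverse_degree_two_splits_off:
  fixes v :: "'n::finite \<Rightarrow> nat^'n"
  assumes deg: "has_degree v 2" and sh: "shifted_inverse v w \<gamma>" and degw: "has_degree w 2"
  obtains a b c where "\<And>j. splits_off (graph_edges v) a b c j"
proof -
  fix j0 :: 'n
  have "(\<Sum>l\<in>UNIV. \<Sum>k\<in>UNIV. w j0 $ k * v k $ l) = (\<Sum>k\<in>UNIV. w j0 $ k * (\<Sum>l\<in>UNIV. v k $ l))"
    unfolding sum_distrib_left by (rule sum.swap)
  also have "\<dots> = 4" using deg degw unfolding has_degree_def by (simp flip: sum_distrib_right)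
  finally have "(\<Sum>l\<in>UNIV. \<gamma> $ l) + 1 = 4"
    using sh unfolding shifted_inverse_def by (simp add: sum.distrib of_bool_def)
  then have "(\<Sum>l\<in>UNIV. \<gamma> $ l) = 3" by simp
  then obtain a b c where \<gamma>: "\<gamma> = axis a 1 + axis b 1 + axis c 1" by (rule vec_degree_three)
  have edge: "\<exists>p q. v k = axis p 1 + axis q 1 \<and> {p, q} \<in> graph_edges v" for k
    using deg vec_degree_two[of "v k"] unfolding has_degree_def by (metis graph_edges_iff rangeI)
  have "splits_off (graph_edges v) a b c j" for j
  proof -
    obtain k m where km: "w j = axis k 1 + axis m 1"
      using degw vec_degree_two[of "w j"] unfolding has_degree_def by metis
    obtain p q p' q' where pq: "v k = axis p 1 + axis q 1" "{p, q} \<in> graph_edges v"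
      "v m = axis p' 1 + axis q' 1" "{p', q'} \<in> graph_edges v" using edge[of k] edge[of m] by blast
    have "v k $ l + v m $ l = \<gamma> $ l + of_bool (l = j)" for l
      using sh axis_pair_sum[of k m "\<lambda>i. v i $ l"] unfolding shifted_inverse_def km[symmetric] by simp
    then have "v k + v m = \<gamma> + axis j 1" by (simp add: vec_eq_iff axis_nth_of_bool)
    then show ?thesis unfolding pq(1,3) \<gamma> using pq(2,4) by (rule edge_pair_splits_off)
  qed
  then show ?thesis by (rule that)
qed

text \<open>
  Every vertex outside of \<open>B\<close> takes up one edge of its own, joining it to \<open>B\<close>. With as many edges as
  vertices, at most \<open>card B\<close> edges remain, so \<open>card B\<close> edges inside \<open>B\<close> leave room for no others.
\<close>

lemma edges_of_core_and_leaves: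
  fixes E :: "'a::finite set set"
  assumes E: "card E = CARD('a)" and K: "K \<subseteq> E" "K \<subseteq> Pow B" "card B \<le> card K"
    and p: "\<And>j. j \<notin> B \<Longrightarrow> p j \<in> B \<and> {j, p j} \<in> E"
  shows "card K = card B" and "E = K \<union> (\<lambda>j. {j, p j}) ` (- B)"
proof -
  let ?L = "(\<lambda>j. {j, p j}) ` (- B)"
  have "inj_on (\<lambda>j. {j, p j}) (- B)"
  proof (rule inj_onI)
    fix i j assume "i \<in> - B" "j \<in> - B" "{i, p i} = {j, p j}"
    then show "i = j" using p[of i] p[of j] by (auto simp: doubleton_eq_iff)
  qed
  then have L: "card ?L = CARD('a) - card B" by (simp add: card_image Compl_eq_Diff_UNIV card_Diff_subset)
  have "K \<inter> ?L = {}" using K(2) by auto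
  then have card: "card (K \<union> ?L) = card K + (CARD('a) - card B)"
    using L by (simp add: card_Un_disjoint)
  have sub: "K \<union> ?L \<subseteq> E" using K(1) p by auto
  have B: "card B \<le> CARD('a)" by (simp add: card_mono)
  have le: "card (K \<union> ?L) \<le> CARD('a)" using card_mono[OF _ sub] E by simp
  show "card K = card B" using le card K(3) B by linarith
  show "E = K \<union> ?L" using card_seteq[OF _ sub] card E K(3) B by simp
qed

text \<open>
  The two shapes of a graph satisfying the combinatorial condition. The value \<open>p j\<close> is the only
  neighbour of the leaf \<open>j\<close>.
\<close>

definition triangle_with_leaves :: "'a set set \<Rightarrow> 'a \<Rightarrow> 'a \<Rightarrow> 'a \<Rightarrow> ('a \<Rightarrow> 'a) \<Rightarrow> bool" where
  "triangle_with_leaves E a b c p \<longleftrightarrow> distinct [a, b, c] \<and> (\<forall>j. j \<notin> {a, b, c} \<longrightarrow> p j \<in> {a, b, c}) \<and>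
     E = {{a, b}, {b, c}, {a, c}} \<union> (\<lambda>j. {j, p j}) ` (- {a, b, c})"

definition looped_edge_with_leaves :: "'a set set \<Rightarrow> 'a \<Rightarrow> 'a \<Rightarrow> ('a \<Rightarrow> 'a) \<Rightarrow> bool" where
  "looped_edge_with_leaves E a b p \<longleftrightarrow> a \<noteq> b \<and> (\<forall>j. j \<notin> {a, b} \<longrightarrow> p j \<in> {a, b}) \<and>
     E = {{a}, {a, b}} \<union> (\<lambda>j. {j, p j}) ` (- {a, b})"

lemma splits_off_swap:
  "splits_off E a b c j \<Longrightarrow> splits_off E b a c j" "splits_off E a b c j \<Longrightarrow> splits_off E a c b j"
  unfolding splits_off_def by (auto simp: insert_commute)

text \<open>
  If the edge \<open>{x, y}\<close> of the triangle is missing, then the splittings for \<open>x\<close> and \<open>y\<close> require the two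
  other edges and loops at \<open>x\<close> and \<open>y\<close>: four edges, while only three are available.
\<close>

lemma splits_off_distinct_imp_triangle:
  fixes E :: "'a::finite set set"
  assumes E: "card E = CARD('a)" and D: "\<And>j. splits_off E a b c j" and abc: "distinct [a, b, c]"
  shows "\<exists>p. triangle_with_leaves E a b c p"
proof -
  have "\<exists>y. y \<in> {a, b, c} \<and> {j, y} \<in> E" for j using D[of j] unfolding splits_off_def by blast
  then obtain p where p: "\<And>j. p j \<in> {a, b, c} \<and> {j, p j} \<in> E" by metis
  note core = edges_of_core_and_leaves[OF E, where B = "{a, b, c}" and p = p]
  have B: "card {a, b, c} = 3" using abc by simp
  have ends: "{x, y} \<in> E" if xyz: "{x, y, z} = {a, b, c}" "distinct [x, y, z]"
    and D: "\<And>j. splits_off E x y z j" for x y z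
  proof (rule ccontr)
    assume no: "{x, y} \<notin> E"
    let ?K = "{{x}, {y}, {x, z}, {y, z}}"
    have "?K \<subseteq> E"
      using D[of x] D[of y] no unfolding splits_off_def by (auto simp: insert_commute)
    moreover have "?K \<subseteq> Pow {a, b, c}" using xyz(1) by blast
    moreover have "card ?K = 4" using xyz(2) by (auto simp: doubleton_eq_iff card_insert_if)
    ultimately show False using core(1)[of ?K] p B by auto
  qed
  have acb: "splits_off E a c b j" and bca: "splits_off E b c a j" for j
    using D[of j] splits_off_swap(2)[of E a b c j] splits_off_swap(2)[of E b a c j]
      splits_off_swap(1)[of E a b c j] by simp_all
  have edges: "{a, b} \<in> E" "{a, c} \<in> E" "{b, c} \<in> E"
    using ends[of a b c] ends[of a c b] ends[of b c a] D acb bca abc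
    by (auto simp: insert_commute)
  have "card {{a, b}, {b, c}, {a, c}} = 3" using abc by (auto simp: doubleton_eq_iff card_insert_if)
  then have "E = {{a, b}, {b, c}, {a, c}} \<union> (\<lambda>j. {j, p j}) ` (- {a, b, c})"
    using core(2)[of "{{a, b}, {b, c}, {a, c}}"] p edges B by auto
  moreover have "\<forall>j. j \<notin> {a, b, c} \<longrightarrow> p j \<in> {a, b, c}" using p by blast
  ultimately show ?thesis
    unfolding triangle_with_leaves_def using abc by (intro exI[of _ p] conjI)
qed

text \<open>
  In the case \<open>a = b\<close> the graph would be a star with a loop at its centre \<open>a\<close>, and \<open>x\<^sub>a\<close> a common factor.
\<close>

lemma splits_off_repeated_imp_looped_edge:
  fixes E :: "'a::finite set set"
  assumes E: "card E = CARD('a)" and D: "\<And>j. splits_off E a a b j" and nocommon: "\<And>x. \<exists>e\<in>E. x \<notin> e"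
  shows "\<exists>p. looped_edge_with_leaves E a b p"
proof -
  have "\<exists>y. y \<in> {a, b} \<and> {j, y} \<in> E" for j using D[of j] unfolding splits_off_def by blast
  then obtain p where p: "\<And>j. p j \<in> {a, b} \<and> {j, p j} \<in> E" by metis
  have loop: "{a} \<in> E" and ab: "{a, b} \<in> E" using D[of a] unfolding splits_off_def by auto
  note core = edges_of_core_and_leaves[OF E, where B = "{a, b}" and p = p]
  have "a \<noteq> b"
  proof
    assume "a = b"
    then have "E = {{a}} \<union> (\<lambda>j. {j, p j}) ` (- {a, b})" using core(2)[of "{{a}}"] loop p by auto
    moreover have "p j = a" for j using p[of j] \<open>a = b\<close> by simp
    ultimately show False using nocommon[of a] by auto
  qed
  have "E = {{a}, {a, b}} \<union> (\<lambda>j. {j, p j}) ` (- {a, b})"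
    using core(2)[of "{{a}, {a, b}}"] p loop ab \<open>a \<noteq> b\<close> by auto
  moreover have "\<forall>j. j \<notin> {a, b} \<longrightarrow> p j \<in> {a, b}" using p by blast
  ultimately show ?thesis
    unfolding looped_edge_with_leaves_def using \<open>a \<noteq> b\<close> by (intro exI[of _ p] conjI)
qed

lemma splits_off_shape:
  fixes E :: "'a::finite set set"
  assumes E: "card E = CARD('a)" and D: "\<And>j. splits_off E a b c j" and nocommon: "\<And>x. \<exists>e\<in>E. x \<notin> e"
  shows "(\<exists>a b c p. triangle_with_leaves E a b c p) \<or> (\<exists>a b p. looped_edge_with_leaves E a b p)"
proof (cases "distinct [a, b, c]")
  case True
  then show ?thesis using splits_off_distinct_imp_triangle[OF E D] by blast
next
  case False
  then obtain x y where "\<And>j. splits_off E x x y j"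
    using D splits_off_swap by (metis distinct_length_2_or_more distinct_singleton)
  then show ?thesis using splits_off_repeated_imp_looped_edge[OF E _ nocommon] by blast
qed

section \<open>Circuits, neighborhoods and branching\<close>

abbreviation adj :: "'a set set \<Rightarrow> ('a \<times> 'a) set" where
  "adj E \<equiv> {(a, b). {a, b} \<in> E}"

lemma circuit_dist_eq:
  assumes "c \<in> circuit_vertices E" "(c, i) \<in> adj E ^^ k"
    and "\<And>c m. c \<in> circuit_vertices E \<Longrightarrow> (c, i) \<in> adj E ^^ m \<Longrightarrow> k \<le> m"
  shows "circuit_dist E i = k"
  unfolding circuit_dist_def using assms by (intro Least_equality) blast+

lemma circuit_dist_le:
  assumes "c \<in> circuit_vertices E" "(c, i) \<in> adj E ^^ k"
  shows "circuit_dist E i \<le> k"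
  unfolding circuit_dist_def using assms by (intro Least_le) blast

text \<open>
  A vertex not adjacent to the circuit would be cut off from the circuit and its neighbours; an edge
  crossing that cut belongs to the second neighborhood.
\<close>

lemma all_near_circuit:
  fixes E :: "'a::finite set set"
  assumes con: "crossing_connected E" and ne: "circuit_vertices E \<noteq> {}"
    and s2: "card (neighborhood_edges E 2) = 0" and j: "j \<notin> circuit_vertices E"
  shows "\<exists>y \<in> circuit_vertices E. {j, y} \<in> E"
proof (rule ccontr)
  assume no: "\<not> ?thesis"
  let ?V = "circuit_vertices E"
  define S where "S = ?V \<union> {y. \<exists>x\<in>?V. {x, y} \<in> E}"
  obtain c where "c \<in> ?V" using ne by blast
  then have "c \<in> S" "j \<notin> S" using no j by (auto simp: S_def insert_commute)
  then obtain x y where xy: "x \<in> S" "y \<notin> S" "{x, y} \<in> E" using crossing_edge[OF con] by metis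
  have "x \<notin> ?V" using xy by (auto simp: S_def)
  then obtain z where z: "z \<in> ?V" "{z, x} \<in> E" using xy(1) by (auto simp: S_def)
  have "circuit_dist E x = 1"
  proof (rule circuit_dist_eq[OF z(1)])
    fix c m assume "c \<in> ?V" "(c, x) \<in> adj E ^^ m"
    then show "1 \<le> m" using \<open>x \<notin> ?V\<close> by (cases m) auto
  qed (use z in simp)
  moreover have "circuit_dist E y = 2"
  proof (rule circuit_dist_eq[OF z(1)])
    show "(z, y) \<in> adj E ^^ 2" using z xy by (auto simp: numeral_2_eq_2)
    fix c m assume c: "c \<in> ?V" "(c, y) \<in> adj E ^^ m"
    have "m \<noteq> 0"
    proof
      assume "m = 0"
      then show False using c xy(2) by (simp add: S_def)
    qed
    moreover have "m \<noteq> 1"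
    proof
      assume "m = 1"
      then have "{c, y} \<in> E" using c(2) by simp
      then show False using c(1) xy(2) by (auto simp: S_def)
    qed
    ultimately show "2 \<le> m" by simp
  qed
  ultimately have "{x, y} \<in> neighborhood_edges E 2"
    using xy(3) by (auto simp: neighborhood_edges_def)
  then show False using s2 by auto
qed

lemma no_second_neighborhood:
  assumes "\<And>j. j \<notin> circuit_vertices E \<Longrightarrow> \<exists>y \<in> circuit_vertices E. {j, y} \<in> E"
  shows "neighborhood_edges E 2 = {}"
proof -
  have "circuit_dist E j \<le> 1" for j
  proof (cases "j \<in> circuit_vertices E")
    case True
    then show ?thesis using circuit_dist_le[of j E j 0] by simp
  next
    case False
    then show ?thesis using assms circuit_dist_le[of _ E j 1] by (fastforce simp: insert_commute)
  qed
  then have "circuit_dist E j \<noteq> 2" for j by (metis numeral_le_one_iff semiring_norm(69))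
  then show ?thesis by (auto simp: neighborhood_edges_def)
qed

lemma vertex_degree_two_iff:
  fixes E :: "'a::finite set set"
  assumes "{i} \<notin> E"
  shows "2 \<le> vertex_degree E i \<longleftrightarrow> (\<exists>e\<in>E. \<exists>f\<in>E. e \<noteq> f \<and> i \<in> e \<and> i \<in> f)"
proof -
  have "2 \<le> vertex_degree E i \<longleftrightarrow> \<not> card {e \<in> E. i \<in> e} \<le> Suc 0"
    using assms by (simp add: vertex_degree_def) linarith
  then show ?thesis by (auto simp: card_le_Suc0_iff_eq)
qed

lemma two_neighbours_imp_degree_two:
  fixes E :: "'a::finite set set"
  assumes "{i, x} \<in> E" "{i, y} \<in> E" "x \<noteq> y"
  shows "2 \<le> vertex_degree E i"
proof -
  have "card {{i, x}, {i, y}} \<le> card {e \<in> E. i \<in> e}" using assms by (intro card_mono) auto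
  then show ?thesis using assms(3) by (simp add: vertex_degree_def doubleton_eq_iff card_insert_if)
qed

text \<open>
  A vertex other than \<open>a\<close> and \<open>b\<close> has at most one neighbour. Hence neither \<open>b\<close> with its leaves nor \<open>a\<close> and
  \<open>b\<close> with their leaves can be left by an edge, except from \<open>b\<close> to \<open>a\<close>.
\<close>

lemma unique_branching_vertex:
  fixes E :: "'a::finite set set"
  assumes con: "crossing_connected E" and V: "circuit_vertices E = {a}"
    and b: "off_circuit_branching E = {b}"
  shows "a \<noteq> b" "{a, b} \<in> E" "j \<notin> {a, b} \<Longrightarrow> \<exists>y\<in>{a, b}. {j, y} \<in> E"
proof -
  show "a \<noteq> b" using b V by (auto simp: off_circuit_branching_def)
  have leaf: "y = z" if "x \<notin> {a, b}" "{x, y} \<in> E" "{x, z} \<in> E" for x y z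
    using that b V two_neighbours_imp_degree_two[of x y E z]
    by (auto simp: off_circuit_branching_def)
  show "{a, b} \<in> E"
  proof (rule ccontr)
    assume no: "{a, b} \<notin> E"
    define S where "S = {b} \<union> {x. x \<noteq> a \<and> {b, x} \<in> E}"
    have "b \<in> S" "a \<notin> S" using \<open>a \<noteq> b\<close> by (auto simp: S_def)
    then obtain x y where xy: "x \<in> S" "y \<notin> S" "{x, y} \<in> E" using crossing_edge[OF con] by metis
    show False
    proof (cases "x = b")
      case True
      then show ?thesis using xy no by (auto simp: S_def insert_commute)
    next
      case False
      then have "x \<notin> {a, b}" "{x, b} \<in> E" using xy by (auto simp: S_def insert_commute)
      then show ?thesis using leaf xy \<open>b \<in> S\<close> by blast
    qed
  qed
  assume j: "j \<notin> {a, b}"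
  show "\<exists>y\<in>{a, b}. {j, y} \<in> E"
  proof (rule ccontr)
    assume no: "\<not> ?thesis"
    define N where "N = {a, b} \<union> {x. {x, a} \<in> E \<or> {x, b} \<in> E}"
    have "a \<in> N" "j \<notin> N" using j no by (auto simp: N_def)
    then obtain x y where xy: "x \<in> N" "y \<notin> N" "{x, y} \<in> E" using crossing_edge[OF con] by metis
    have "x \<notin> {a, b}" using xy by (auto simp: N_def insert_commute)
    then obtain z where "z \<in> {a, b}" "{x, z} \<in> E" using xy(1) by (auto simp: N_def)
    then have "y \<in> {a, b}" using leaf \<open>x \<notin> {a, b}\<close> xy(3) by metis
    then show False using xy(2) by (auto simp: N_def)
  qed
qed

lemma triangle_with_leaves_invariants:
  fixes E :: "'a::finite set set"
  assumes "crossing_connected E" "card E = CARD('a)" "triangle_with_leaves E a b c p"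
  shows "circuit_size E = 3" "card (neighborhood_edges E 2) = 0"
proof -
  have abc: "distinct [a, b, c]" and p: "\<And>j. j \<notin> {a, b, c} \<Longrightarrow> p j \<in> {a, b, c}"
    and E: "E = {{a, b}, {b, c}, {a, c}} \<union> (\<lambda>j. {j, p j}) ` (- {a, b, c})"
    using assms(3) unfolding triangle_with_leaves_def by blast+
  have C: "is_circuit E {{a, b}, {b, c}, {a, c}} \<and> card {{a, b}, {b, c}, {a, c}} = 3"
    unfolding is_circuit_triangle_iff using abc E by blast
  then have the: "the_circuit E = {{a, b}, {b, c}, {a, c}}"
    using the_circuit_eq[OF assms(1,2)] by blast
  show "circuit_size E = 3" using C unfolding circuit_size_def the by blast
  have V: "circuit_vertices E = {a, b, c}" unfolding circuit_vertices_def the by auto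
  have "neighborhood_edges E 2 = {}"
  proof (rule no_second_neighborhood)
    fix j assume "j \<notin> circuit_vertices E"
    then show "\<exists>y\<in>circuit_vertices E. {j, y} \<in> E"
      unfolding V using p[of j] by (intro bexI[of _ "p j"]) (auto simp: E)
  qed
  then show "card (neighborhood_edges E 2) = 0" by simp
qed

text \<open>
  Some leaf hangs on \<open>b\<close>, since otherwise \<open>a\<close> would be an end of every edge; so \<open>b\<close> has degree at least
  two, whereas a leaf has degree one.
\<close>

lemma looped_edge_with_leaves_invariants:
  fixes E :: "'a::finite set set"
  assumes "crossing_connected E" "card E = CARD('a)" "looped_edge_with_leaves E a b p"
    and nocommon: "\<And>x. \<exists>e\<in>E. x \<notin> e"
  shows "circuit_size E = 1" "card (off_circuit_branching E) = 1"
proof -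
  have ab: "a \<noteq> b" and p: "\<And>j. j \<notin> {a, b} \<Longrightarrow> p j \<in> {a, b}"
    and E: "E = {{a}, {a, b}} \<union> (\<lambda>j. {j, p j}) ` (- {a, b})"
    using assms(3) unfolding looped_edge_with_leaves_def by blast+
  have C: "is_circuit E {{a}}" using is_circuit_loop_iff[of E "{{a}}"] E by blast
  then have the: "the_circuit E = {{a}}" using the_circuit_eq[OF assms(1,2)] by blast
  show "circuit_size E = 1" by (simp add: circuit_size_def the)
  have V: "circuit_vertices E = {a}" unfolding circuit_vertices_def the by simp
  obtain j where j: "j \<notin> {a, b}" "p j = b" using nocommon[of a] p unfolding E by auto
  have "2 \<le> vertex_degree E b"
    using two_neighbours_imp_degree_two[of b a E j] j by (auto simp: E insert_commute)
  moreover have "\<not> 2 \<le> vertex_degree E i" if i: "i \<notin> {a, b}" for i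
  proof -
    have "{i} \<notin> E" using i p[OF i] by (auto simp: E)
    moreover have "e = {i, p i}" if "e \<in> E" "i \<in> e" for e using that i p by (auto simp: E)
    ultimately show ?thesis using vertex_degree_two_iff by metis
  qed
  ultimately have "off_circuit_branching E = {b}"
    using ab unfolding off_circuit_branching_def V by auto
  then show "card (off_circuit_branching E) = 1" by simp
qed

section \<open>Sets that coincide with their inverse\<close>

lemma p_involution_iff:
  "p_involution v \<longleftrightarrow> (\<exists>\<sigma> \<tau>. \<sigma> permutes UNIV \<and> \<tau> permutes UNIV \<and>
     (\<forall>x y. inverse_set v x $ \<sigma> y = v (\<tau> x) $ y))"
proof -
  have perm: "log_matrix w = (\<chi> i j. if i = \<sigma> j then 1 else 0) ** log_matrix v **
        (\<chi> i j. if i = \<tau> j then 1 else 0) \<longleftrightarrow> (\<forall>x y. w x $ \<sigma> y = v (\<tau> x) $ y)"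
    if "\<sigma> permutes UNIV" for \<sigma> \<tau> :: "'a \<Rightarrow> 'a" and v w
  proof -
    have eq: "(i = \<sigma> l) = (l = inv \<sigma> i)" for i l using that by (metis permutes_inverses)
    have "((\<chi> i j. if i = \<sigma> j then 1 else 0) ** log_matrix v **
        (\<chi> i j. if i = \<tau> j then 1 else 0)) $ i $ j = v (\<tau> j) $ (inv \<sigma> i)" for i j
      by (simp add: matrix_matrix_mult_def log_matrix_def eq if_distrib[of "\<lambda>x. x * _"]
          if_distrib[of "(*) _"] cong: if_cong)
    then show ?thesis
      using that by (simp add: vec_eq_iff log_matrix_def) (metis permutes_inverses)
  qed
  show ?thesis unfolding p_involution_def permutation_matrix_def using perm by blast
qed

lemma p_involution_degree:
  fixes v :: "'n::finite \<Rightarrow> nat^'n"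
  assumes "p_involution v" "has_degree v d"
  shows "has_degree (inverse_set v) d"
proof -
  obtain \<sigma> \<tau> :: "'n \<Rightarrow> 'n" where \<sigma>: "\<sigma> permutes UNIV" and eq: "\<And>x y. inverse_set v x $ \<sigma> y = v (\<tau> x) $ y"
    using assms(1) unfolding p_involution_iff by blast
  have "(\<Sum>i\<in>UNIV. inverse_set v x $ i) = d" for x
  proof -
    have "(\<Sum>i\<in>UNIV. inverse_set v x $ i) = (\<Sum>y\<in>UNIV. inverse_set v x $ \<sigma> y)"
      using sum.permute[OF \<sigma>, of "\<lambda>i. inverse_set v x $ i"] by (simp add: comp_def)
    then show ?thesis using assms(2) by (simp add: eq has_degree_def)
  qed
  then show ?thesis by (simp add: has_degree_def)
qed

text \<open>
  The source of p-involutions. Label each vertex \<open>x\<close> with an edge, or rather its index \<open>\<phi> x\<close>, and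
  transport the set along \<open>\<phi>\<close>: the monomial \<open>w x\<close> has as its variables the labels of the two ends of the
  edge labelling \<open>x\<close>. The hypothesis on sums says exactly that this transported set solves the
  equation of the inverse set, so the inverse is a relabelling of the set by \<open>\<phi>\<close> on both sides.
\<close>

lemma p_involution_of_edge_labelling:
  fixes v :: "'n::finite \<Rightarrow> nat^'n" and q r :: "'n \<Rightarrow> 'n"
  assumes "CARD('n) \<ge> 2" and ind: "lin_indep v" and deg: "has_degree v 2" and can: "canonical_restrictions v"
    and edge: "\<And>x. {q x, r x} \<in> graph_edges v"
    and sum: "\<And>x. axis (q (q x)) 1 + axis (r (q x)) 1 + (axis (q (r x)) 1 + axis (r (r x)) 1) =
      \<gamma> + (axis x 1 :: nat^'n)"
  shows "p_involution v"
proof -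
  have "\<exists>k. v k = axis (q x) 1 + axis (r x) 1" for x
    using edge[of x] unfolding graph_edges_iff by auto
  then obtain \<phi> where \<phi>: "\<And>x. v (\<phi> x) = axis (q x) 1 + axis (r x) 1" by metis
  have inj: "inj \<phi>"
  proof (rule injI)
    fix x y assume "\<phi> x = \<phi> y"
    then have "{q x, r x} = {q y, r y}" using \<phi>[of x] \<phi>[of y] axis_pair_eq_iff by metis
    then have "\<gamma> + axis x 1 = \<gamma> + axis y 1"
      unfolding sum[symmetric] by (auto simp: doubleton_eq_iff ac_simps)
    then show "x = y" by (simp add: axis_eq_axis)
  qed
  then have bij: "bij \<phi>" by (simp add: bij_def finite_UNIV_inj_surj)
  define w :: "'n \<Rightarrow> nat^'n" where "w x = axis (\<phi> (q x)) 1 + axis (\<phi> (r x)) 1" for x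
  have w\<phi>: "w x $ \<phi> y = v (\<phi> x) $ y" for x y
    using inj by (simp add: w_def \<phi> axis_nth_of_bool inj_eq)
  have "shifted_inverse v w \<gamma>"
    unfolding shifted_inverse_def
  proof (intro allI)
    fix x l
    have "(\<Sum>k\<in>UNIV. w x $ k * v k $ l) = (v (\<phi> (q x)) + v (\<phi> (r x))) $ l"
      unfolding w_def axis_pair_sum by simp
    also have "v (\<phi> (q x)) + v (\<phi> (r x)) = \<gamma> + axis x 1" unfolding \<phi> by (rule sum)
    finally show "(\<Sum>k\<in>UNIV. w x $ k * v k $ l) = \<gamma> $ l + of_bool (l = x)"
      by (simp add: axis_nth_of_bool)
  qed
  moreover have "has_degree w 2"
    by (simp add: has_degree_def w_def axis_def sum.distrib)
  moreover have "\<exists>x. w x $ i = 0" for i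
  proof -
    obtain y where y: "i = \<phi> y" using bij by (metis bij_pointE)
    obtain k where "v k $ y = 0"
      using can unfolding canonical_restrictions_def no_common_factor_iff by blast
    moreover obtain x where "k = \<phi> x" using bij by (metis bij_pointE)
    ultimately show ?thesis using y w\<phi> by metis
  qed
  ultimately have "inverse_set v = w" by (rule inverse_set_eqI(2)[OF assms(1) ind deg])
  then show ?thesis
    unfolding p_involution_iff using bij_imp_permutes[of \<phi> UNIV] bij w\<phi> by auto
qed

text \<open>
  Label each vertex of the triangle with the opposite edge and each leaf with its own edge. The
  shift is \<open>\<gamma> = e\<^sub>a + e\<^sub>b + e\<^sub>c\<close>: two edges of the triangle add up to \<open>\<gamma>\<close> plus the vertex they share, and the
  edge of a leaf \<open>j\<close> and the edge opposite to its neighbour add up to \<open>\<gamma> + e\<^sub>j\<close>.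
\<close>

lemma p_involution_of_triangle:
  fixes v :: "'n::finite \<Rightarrow> nat^'n"
  assumes v: "CARD('n) \<ge> 2" "lin_indep v" "has_degree v 2" "canonical_restrictions v"
    and abc: "distinct [a, b, c]" and tri: "{{a, b}, {b, c}, {a, c}} \<subseteq> graph_edges v"
    and leaf: "\<And>j. j \<notin> {a, b, c} \<Longrightarrow> \<exists>y\<in>{a, b, c}. {j, y} \<in> graph_edges v"
  shows "p_involution v"
proof -
  obtain p where p: "\<And>j. j \<notin> {a, b, c} \<Longrightarrow> p j \<in> {a, b, c} \<and> {j, p j} \<in> graph_edges v"
    using leaf by metis
  define q where "q x = (if x = a then b else if x = b \<or> x = c then a else x)" for x
  define r where "r x = (if x = a \<or> x = b then c else if x = c then b else p x)" for x
  show ?thesis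
  proof (rule p_involution_of_edge_labelling[OF v, of q r "axis a 1 + axis b 1 + axis c 1"])
    fix x
    show "{q x, r x} \<in> graph_edges v" using tri p[of x] by (auto simp: q_def r_def)
    show "axis (q (q x)) 1 + axis (r (q x)) 1 + (axis (q (r x)) 1 + axis (r (r x)) 1) =
        axis a 1 + axis b 1 + axis c 1 + (axis x 1 :: nat^'n)"
      using abc p[of x] by (auto simp: q_def r_def ac_simps)
  qed
qed

text \<open>
  Here \<open>a\<close> is labelled with the edge \<open>{a, b}\<close>, \<open>b\<close> with the loop at \<open>a\<close>, and each leaf with its own edge;
  \<open>\<gamma> = 2 e\<^sub>a + e\<^sub>b\<close>. The inverse thus has its loop at the variable that belongs to
  the edge \<open>{a, b}\<close>.
\<close>

lemma p_involution_of_looped_edge: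
  fixes v :: "'n::finite \<Rightarrow> nat^'n"
  assumes v: "CARD('n) \<ge> 2" "lin_indep v" "has_degree v 2" "canonical_restrictions v"
    and ab: "a \<noteq> b" and core: "{a} \<in> graph_edges v" "{a, b} \<in> graph_edges v"
    and leaf: "\<And>j. j \<notin> {a, b} \<Longrightarrow> \<exists>y\<in>{a, b}. {j, y} \<in> graph_edges v"
  shows "p_involution v"
proof -
  obtain p where p: "\<And>j. j \<notin> {a, b} \<Longrightarrow> p j \<in> {a, b} \<and> {j, p j} \<in> graph_edges v"
    using leaf by metis
  define q where "q x = (if x = a \<or> x = b then a else x)" for x
  define r where "r x = (if x = a then b else if x = b then a else p x)" for x
  show ?thesis
  proof (rule p_involution_of_edge_labelling[OF v, of q r "axis a 1 + axis a 1 + axis b 1"])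
    fix x
    show "{q x, r x} \<in> graph_edges v" using core p[of x] by (auto simp: q_def r_def)
    show "axis (q (q x)) 1 + axis (r (q x)) 1 + (axis (q (r x)) 1 + axis (r (r x)) 1) =
        axis a 1 + axis a 1 + axis b 1 + (axis x 1 :: nat^'n)"
      using ab p[of x] by (auto simp: q_def r_def ac_simps)
  qed
qed

section \<open>The equivalence\<close>

theorem proposition2p8:
  fixes v :: "'n::finite \<Rightarrow> nat^'n" and r s s2 :: nat
  assumes "CARD('n) \<ge> 2"
    and "cremona_set TYPE('k::field) v"
    and "has_degree v 2"
    and "canonical_restrictions v"
    and "r = circuit_size (graph_edges v)"
    and "s = card (off_circuit_branching (graph_edges v))"
    and "s2 = card (neighborhood_edges (graph_edges v) 2)"
  shows "(p_involution v \<longleftrightarrow> has_degree (inverse_set v) 2) \<and>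
         (has_degree (inverse_set v) 2 \<longleftrightarrow> (r = 3 \<and> s2 = 0) \<or> (r = 1 \<and> s = 1))"
proof -
  let ?E = "graph_edges v"
  obtain i :: 'n and c :: "'n \<Rightarrow> 'n \<Rightarrow> int"
    where c: "\<And>j l. (\<Sum>k\<in>UNIV. c j k * int (v k $ l)) = of_bool (l = j) - of_bool (l = i)"
    by (rule cremona_lattice[OF assms(2)]) (rule that)
  have ind: "lin_indep v" by (rule lin_indep_of_differences[OF assms(3) _ c]) simp
  have inv: "is_inverse_set v (inverse_set v)"
    by (rule is_inverse_set_inverse_set[OF assms(1,3) _ c]) simp
  have con: "crossing_connected ?E" by (rule graph_connected[OF assms(3) c])
  have card: "card ?E = CARD('n)"
    using assms(2,3) by (intro card_graph_edges) (auto simp: cremona_set_def monomial_set_def)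
  have circ: "is_circuit ?E (the_circuit ?E)"
    by (rule is_circuit_the_circuit[OF con card graph_edges_doubleton])
  note nocommon = graph_edges_no_common_vertex[OF assms(3,4)]
  have a_b: "has_degree (inverse_set v) 2" if "p_involution v"
    using that assms(3) by (rule p_involution_degree)
  have b_c: "(r = 3 \<and> s2 = 0) \<or> (r = 1 \<and> s = 1)" if b: "has_degree (inverse_set v) 2"
  proof -
    obtain \<gamma> where "shifted_inverse v (inverse_set v) \<gamma>"
      using inv unfolding is_inverse_set_def log_matrix_product_iff by blast
    then obtain a b c where "\<And>j. splits_off ?E a b c j"
      using inverse_degree_two_splits_off[OF assms(3) _ b] by blast
    then have "(\<exists>a b c p. triangle_with_leaves ?E a b c p) \<or> (\<exists>a b p. looped_edge_with_leaves ?E a b p)"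
      by (rule splits_off_shape[OF card _ nocommon])
    then show ?thesis
      using triangle_with_leaves_invariants[OF con card]
        looped_edge_with_leaves_invariants[OF con card _ nocommon] assms(5-7) by metis
  qed
  have c_a: "p_involution v" if "(r = 3 \<and> s2 = 0) \<or> (r = 1 \<and> s = 1)"
    using that
  proof (elim disjE conjE)
    assume "r = 3" "s2 = 0"
    then obtain a b c where abc: "distinct [a, b, c]" and C: "the_circuit ?E = {{a, b}, {b, c}, {a, c}}"
      and sub: "the_circuit ?E \<subseteq> ?E"
      using circ is_circuit_triangle_iff[of ?E "the_circuit ?E"] assms(5) unfolding circuit_size_def by metis
    have V: "circuit_vertices ?E = {a, b, c}" unfolding circuit_vertices_def C by auto
    have "\<exists>y\<in>{a, b, c}. {j, y} \<in> ?E" if "j \<notin> {a, b, c}" for j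
      using all_near_circuit[OF con, of j] V that \<open>s2 = 0\<close> assms(7) by simp
    then show ?thesis
      using p_involution_of_triangle[OF assms(1) ind assms(3,4) abc] sub C by simp
  next
    assume "r = 1" "s = 1"
    then obtain a where a: "{a} \<in> ?E" and C: "the_circuit ?E = {{a}}"
      using circ is_circuit_loop_iff[of ?E "the_circuit ?E"] assms(5) unfolding circuit_size_def by metis
    have V: "circuit_vertices ?E = {a}" unfolding circuit_vertices_def C by simp
    obtain b where b: "off_circuit_branching ?E = {b}"
      using \<open>s = 1\<close> assms(6) by (metis card_1_singletonE)
    show ?thesis
      using p_involution_of_looped_edge[OF assms(1) ind assms(3,4)]
        unique_branching_vertex[OF con V b] a by blast
  qed
  show ?thesis using a_b b_c c_a by blast
qed

end
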